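(* Let $\beta\in\mathbb{C}$ with $|\beta|=1$ and $\beta^n\neq 1$ for all $n\in\mathbb{N}$. Let $m\in\mathrm{Hol}(\mathbb{D})$ be such that $m(z_0)=0$ for some $z_0\in\mathbb{D}$. Consider $T:\mathrm{Hol}(\mathbb{D})\to\mathrm{Hol}(\mathbb{D})$ given by $(Tf)(z)=m(z)f(\beta z)$, $z\in\mathbb{D}$. Then $\sigma_W(T)=\{\lambda\in\mathbb{C}:|\lambda|\leq M_1\}$ if $M_1<\infty$, and $\sigma_W(T)=\mathbb{C}$ if $M_1=\infty$.
   Context: $\mathbb{D}$ is the open unit disc and $\mathrm{Hol}(\mathbb{D})$ is the Fréchet space of holomorphic functions on $\mathbb{D}$ with the topology of uniform convergence on compact subsets, given by the seminorms $\|f\|_{A(r\mathbb{D})}=\sup_{|z|\leq r}|f(z)|$, $0<r<1$. For a continuous linear operator $T$ on $\mathrm{Hol}(\mathbb{D})$, $\rho(T)$ is the set of $\lambda\in\mathbb{C}$ with $\lambda\mathrm{Id}-T$ bijective, and $R_\lambda=(\lambda\mathrm{Id}-T)^{-1}$ for $\lambda\in\rho(T)$. The Waelbroeck resolvent set $\rho_W(T)$ is the set of $\lambda\in\rho(T)$ for which there is $\delta>0$ with $\overline{D}(\lambda,\delta)\subset\rho(T)$ and $\sup_{|\mu-\lambda|\leq\delta}\|R_\mu f\|_{A(r\mathbb{D})}<\infty$ for all $f\in\mathrm{Hol}(\mathbb{D})$ and all $0<r<1$; the Waelbroeck spectrum is $\sigma_W(T)=\mathbb{C}\setminus\rho_W(T)$.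 For $0<r<1$, $M_r:=\exp\left(\frac{1}{2\pi}\int_0^{2\pi}\log|m(re^{it})|\,dt\right)$, and $M_1:=\sup_{0<r<1}M_r\in[0,\infty]$. *)

theory Defs
  imports "HOL-Analysis.Analysis"
begin

text \<open>Hol(D): holomorphic functions on the open unit disc, normalised to be 0 outside
  the disc, so that each element of Hol(D) has exactly one representative.\<close>
definition HolD :: "(complex \<Rightarrow> complex) set" where
  "HolD = {f. f holomorphic_on ball 0 1 \<and> (\<forall>z. z \<notin> ball 0 1 \<longrightarrow> f z = 0)}"

definition semi_norm_A :: "real \<Rightarrow> (complex \<Rightarrow> complex) \<Rightarrow> real" where
  "semi_norm_A r f = (SUP z\<in>cball 0 r. cmod (f z))"

definition resolvent_set ::
  "((complex \<Rightarrow> complex) \<Rightarrow> (complex \<Rightarrow> complex)) \<Rightarrow> complex set" where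
  "resolvent_set T = {lam. bij_betw (\<lambda>f. (\<lambda>z. lam * f z - T f z)) HolD HolD}"

definition resolvent ::
  "((complex \<Rightarrow> complex) \<Rightarrow> (complex \<Rightarrow> complex)) \<Rightarrow> complex \<Rightarrow>
     (complex \<Rightarrow> complex) \<Rightarrow> (complex \<Rightarrow> complex)" where
  "resolvent T lam = inv_into HolD (\<lambda>f. (\<lambda>z. lam * f z - T f z))"

definition waelbroeck_resolvent_set ::
  "((complex \<Rightarrow> complex) \<Rightarrow> (complex \<Rightarrow> complex)) \<Rightarrow> complex set" where
  "waelbroeck_resolvent_set T = {lam. lam \<in> resolvent_set T \<and>
     (\<exists>\<delta>>0. cball lam \<delta> \<subseteq> resolvent_set T \<and>
        (\<forall>f\<in>HolD. \<forall>r. 0 < r \<and> r < 1 \<longrightarrow>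
           bdd_above ((\<lambda>mu. semi_norm_A r (resolvent T mu f)) ` cball lam \<delta>)))}"

definition waelbroeck_spectrum ::
  "((complex \<Rightarrow> complex) \<Rightarrow> (complex \<Rightarrow> complex)) \<Rightarrow> complex set" where
  "waelbroeck_spectrum T = UNIV - waelbroeck_resolvent_set T"

definition weighted_comp ::
  "(complex \<Rightarrow> complex) \<Rightarrow> complex \<Rightarrow> (complex \<Rightarrow> complex) \<Rightarrow> (complex \<Rightarrow> complex)" where
  "weighted_comp m \<beta> f = (\<lambda>z. if z \<in> ball 0 1 then m z * f (\<beta> * z) else 0)"

text \<open>M_r = exp of the mean of log|m| over the circle of radius r. If m vanishes
  identically on the disc, log|m| = -infinity and M_r = exp(-infinity) = 0.
  Otherwise m has only finitely many zeros on the circle (a null set), and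
  log|m(r e^{it})| is integrable.\<close>
definition M_r :: "(complex \<Rightarrow> complex) \<Rightarrow> real \<Rightarrow> real" where
  "M_r m r = (if (\<forall>z\<in>ball 0 1. m z = 0) then 0
     else exp ((1 / (2 * pi)) *
       integral {0..2*pi} (\<lambda>t. ln (cmod (m (complex_of_real r * cis t))))))"

definition M_1 :: "(complex \<Rightarrow> complex) \<Rightarrow> ereal" where
  "M_1 m = (SUP r\<in>{0<..<1}. ereal (M_r m r))"

end

theory Submission
  imports Defs "HOL-Complex_Analysis.Complex_Analysis"
begin

text \<open>On a circle of radius \<^term>\<open>r\<close> free of zeros of \<^term>\<open>m\<close>, the modulus of \<^term>\<open>m\<close> agrees with that
  of \<^term>\<open>exp H\<close> for some \<^term>\<open>H\<close> holomorphic past the circle, and \<^term>\<open>M_r m r = exp (Re (H 0))\<close>.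
  The Birkhoff averages of \<^term>\<open>H\<close> along the irrational rotation converge uniformly to \<^term>\<open>H 0\<close>, so the
  cocycle \<^term>\<open>\<Prod>k<n. m (\<beta> ^ k * z)\<close> grows like \<^term>\<open>M_r m r ^ n\<close> on the circle, uniformly from above and below.

  The upper bound makes the Neumann series of the resolvent converge outside the closed disc of radius \<^term>\<open>M_1 m\<close>.
  For the converse, the lower bound says that on the circle the resolvent equation \<^term>\<open>\<mu> * f z - m z * f (\<beta> * z) = g z\<close>
  with \<^term>\<open>cmod \<mu> < M_r m r\<close> is solved backwards along orbits by a power series in \<^term>\<open>\<mu>\<close>. If an open set of
  such \<^term>\<open>\<mu>\<close> consisted of resolvent points, these solutions would extend holomorphically to the disc, so their contour
  integrals would vanish there and hence, by the identity theorem in \<^term>\<open>\<mu>\<close>, also at \<^term>\<open>\<mu> = 0\<close>. Choosing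
  \<^term>\<open>g z = m z / (z - z0)\<close> for a zero \<^term>\<open>z0\<close> of \<^term>\<open>m\<close> inside the circle, the solution at
  \<^term>\<open>\<mu> = 0\<close> has a simple pole there, a contradiction.\<close>

section \<open>Means of logarithms on circles\<close>

lemma circle_mean_value:
  fixes H :: "complex \<Rightarrow> complex"
  assumes "H holomorphic_on ball 0 R" and "0 < r" "r < R"
  shows "((\<lambda>t. H (complex_of_real r * cis t)) has_integral (2 * pi * H 0)) {0..2*pi}"
proof -
  have "((\<lambda>u. H u / (u - 0)) has_contour_integral (2 * of_real pi * \<i> * H 0)) (circlepath 0 r)"
  proof (rule Cauchy_integral_circlepath)
    show "continuous_on (cball 0 r) H"
      using assms by (intro holomorphic_on_imp_continuous_on holomorphic_on_subset[OF assms(1)]) auto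
    show "H holomorphic_on ball 0 r"
      using assms by (intro holomorphic_on_subset[OF assms(1)]) auto
  qed (use assms in auto)
  then have "((\<lambda>t. H (0 + r * cis t) / (0 + r * cis t - 0) * r * \<i> * cis t) has_integral
      (2 * of_real pi * \<i> * H 0)) {0..2*pi}"
    unfolding circlepath_def
    by (subst (asm) has_contour_integral_part_circlepath_iff) auto
  then have "((\<lambda>t. \<i> * H (r * cis t)) has_integral (\<i> * (2 * pi * H 0))) {0..2*pi}"
    using assms by (simp add: mult_ac)
  from has_integral_mult_right[OF this, of "-\<i>"] show ?thesis
    by (simp add: mult.assoc[symmetric])
qed

text \<open>Turns a finite exceptional set on the circle into a finite set of parameters, across
  which integrands may be altered freely.\<close>

lemma finite_circle_preimage:
  assumes "finite Z" "0 < r"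
  shows "finite {t\<in>{0..2*pi}. complex_of_real r * cis t \<in> Z}"
proof -
  \<comment> \<open>The half-open interval makes the parametrisation injective; the endpoint
    \<open>2*pi\<close> is put back at the end.\<close>
  let ?A = "{t\<in>{0..<2*pi}. complex_of_real r * cis t \<in> Z}"
  have "inj_on (\<lambda>t. complex_of_real r * cis t) ?A"
  proof (rule inj_onI)
    fix x y assume "x \<in> ?A" "y \<in> ?A" "complex_of_real r * cis x = complex_of_real r * cis y"
    then have "cis x = cis y" and xy: "x \<in> {0..<2*pi}" "y \<in> {0..<2*pi}"
      using \<open>0 < r\<close> by auto
    then have "sin x = sin y" "cos x = cos y" by (auto simp: complex_eq_iff)
    then obtain n :: int where n: "x = y + 2 * pi * n" using sin_cos_eq_iff[of x y]
      by (metis mult.assoc mult.commute)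
    have "2 * pi * n < 2 * pi * 1" "2 * pi * (-1) < 2 * pi * n"
      using xy n unfolding atLeastLessThan_iff by linarith+
    moreover have "2 * pi > 0" by simp
    ultimately have "real_of_int n < 1" "- 1 < real_of_int n"
      by (blast dest: iffD1[OF mult_less_cancel_left_pos])+
    then have "n = 0" by linarith
    then show "x = y" using n by simp
  qed
  moreover have "finite ((\<lambda>t. complex_of_real r * cis t) ` ?A)"
    by (rule finite_subset[OF _ assms(1)]) auto
  ultimately have "finite ?A" using finite_imageD by blast
  then have "finite (insert (2*pi) ?A)" by simp
  then show ?thesis by (rule finite_subset[rotated]) auto
qed

text \<open>For \<^term>\<open>cmod a = r\<close> the integrand is singular; it is the decreasing limit of the same function
  on the circles of radius \<^term>\<open>\<rho> > r\<close>, whose means are \<^term>\<open>ln \<rho>\<close>.\<close>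
lemma integrable_ln_circle_linear:
  assumes "0 < r"
  shows "(\<lambda>t. ln (cmod (complex_of_real r * cis t - a))) integrable_on {0..2*pi}"
proof (cases "cmod a = r")
  case False
  then have "complex_of_real r * cis t \<noteq> a" for t using assms by (auto simp: norm_mult)
  then show ?thesis
    by (intro integrable_continuous_real continuous_intros) auto
next
  case True
  define \<rho> where "\<rho> k = r + inverse (real (Suc k))" for k :: nat
  define S where "S = {t\<in>{0..2*pi}. complex_of_real r * cis t \<in> {a}}"
  have finS: "finite S" unfolding S_def using assms by (intro finite_circle_preimage) auto
  have \<rho>: "r < \<rho> k" "\<rho> (Suc k) \<le> \<rho> k" for k
    by (auto simp: \<rho>_def field_simps)
  have \<rho>lim: "\<rho> \<longlonglongrightarrow> r" unfolding \<rho>_def by (rule LIMSEQ_inverse_real_of_nat_add)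
  have nz: "complex_of_real (\<rho> k) * cis t \<noteq> a" for k t
  proof
    assume "complex_of_real (\<rho> k) * cis t = a"
    then have "cmod (complex_of_real (\<rho> k) * cis t) = r" using True by simp
    then show False using \<rho>(1)[of k] assms by (simp add: norm_mult)
  qed
  \<comment> \<open>Monotone convergence asks for a finite limit at every point. At the parameters
    in \<open>S\<close> the logarithms tend to minus infinity, so the value there is reset to
    0.\<close>
  define f where "f k t = (if t \<in> S then 0 else ln (cmod (complex_of_real (\<rho> k) * cis t - a)))" for k t
  have int: "(f k has_integral (2 * pi * ln (\<rho> k))) {0..2*pi}" for k
  proof -
    \<comment> \<open>Since \<open>cmod a = r < \<rho> k\<close>, the function
      \<open>\<rho> k - cnj a * z\<close> has positive real part on the disc of radius
      \<open>R > 1\<close>. Its principal logarithm is thus holomorphic past the unit circle, where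
      its modulus equals that of \<open>\<rho> k * cis t - a\<close>.\<close>
    define R where "R = \<rho> k / r"
    have "R > 1" using \<rho>(1)[of k] assms by (simp add: R_def)
    have pos: "Re (\<rho> k - cnj a * z) > 0" if "z \<in> ball 0 R" for z
    proof -
      have "cmod (cnj a * z) < \<rho> k" using that True assms
        by (simp add: norm_mult R_def field_simps)
      then show ?thesis using complex_Re_le_cmod[of "cnj a * z"] by simp
    qed
    have "(\<lambda>z. Ln (\<rho> k - cnj a * z)) holomorphic_on ball 0 R"
      by (intro holomorphic_intros) (use pos in \<open>fastforce simp: complex_nonpos_Reals_iff\<close>)
    from circle_mean_value[OF this, of 1] \<open>R > 1\<close>
    have "((\<lambda>t. Ln (\<rho> k - cnj a * cis t)) has_integral (2 * pi * Ln (\<rho> k))) {0..2*pi}" by simp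
    then have "((Re \<circ> (\<lambda>t. Ln (\<rho> k - cnj a * cis t))) has_integral Re (2 * pi * Ln (\<rho> k))) {0..2*pi}"
      by (rule has_integral_linear) (rule bounded_linear_Re)
    moreover have "Re (2 * pi * Ln (\<rho> k)) = 2 * pi * ln (\<rho> k)"
      using \<rho>(1)[of k] assms by (simp add: Ln_of_real)
    moreover have "(Re \<circ> (\<lambda>t. Ln (\<rho> k - cnj a * cis t))) t = ln (cmod (complex_of_real (\<rho> k) * cis t - a))" for t
    proof -
      have "complex_of_real (\<rho> k) - cnj a * cis t = cis t * cnj (complex_of_real (\<rho> k) * cis t - a)"
        by (simp add: algebra_simps cis_cnj cis_mult flip: mult.assoc)
      then have e: "cmod (complex_of_real (\<rho> k) - cnj a * cis t) = cmod (complex_of_real (\<rho> k) * cis t - a)"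
        by (simp only: norm_mult complex_mod_cnj norm_cis mult_1)
      have "cmod (complex_of_real (\<rho> k) * cis t - a) \<noteq> 0" using nz[of k t] by simp
      then have "complex_of_real (\<rho> k) - cnj a * cis t \<noteq> 0" using e by fastforce
      then show ?thesis using e by (simp add: Re_Ln)
    qed
    ultimately have "((\<lambda>t. ln (cmod (complex_of_real (\<rho> k) * cis t - a))) has_integral (2 * pi * ln (\<rho> k))) {0..2*pi}"
      by (simp add: o_def)
    then show ?thesis
      by (rule has_integral_spike_finite[OF finS, rotated]) (auto simp: f_def)
  qed
  define g where "g t = (if t \<in> S then 0 else ln (cmod (complex_of_real r * cis t - a)))" for t
  have "g integrable_on {0..2*pi} \<and> (\<lambda>k. integral {0..2*pi} (f k)) \<longlonglongrightarrow> integral {0..2*pi} g"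
  proof (rule monotone_convergence_decreasing)
    show "f k integrable_on {0..2*pi}" for k using int by blast
    show "f (Suc k) t \<le> f k t" if "t \<in> {0..2*pi}" for k t
    proof -
      have "cmod (complex_of_real (\<rho> (Suc k)) * cis t - a) \<le> cmod (complex_of_real (\<rho> k) * cis t - a)"
      proof (rule power2_le_imp_le)
        \<comment> \<open>The squared distance is \<open>s\<^sup>2 - 2 * s * c + r\<^sup>2\<close>,
          which increases in \<open>s\<close> beyond \<open>c\<close>, and \<open>c \<le> r\<close>
          lies below all the radii.\<close>
        define c where "c = Re (cnj a * cis t)"
        have "\<bar>c\<bar> \<le> r" using abs_Re_le_cmod[of "cnj a * cis t"] True by (simp add: c_def norm_mult)
        have e: "(cmod (complex_of_real s * cis t - a))\<^sup>2 = s\<^sup>2 - 2 * s * c + r\<^sup>2" for s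
        proof -
          have "(cmod (complex_of_real s * cis t - a))\<^sup>2 =
            s\<^sup>2 * ((cos t)\<^sup>2 + (sin t)\<^sup>2) - 2 * s * c + ((Re a)\<^sup>2 + (Im a)\<^sup>2)"
            unfolding cmod_power2 c_def by (simp add: power2_eq_square algebra_simps
              del: sin_cos_squared_add sin_cos_squared_add2 sin_cos_squared_add3)
          also have "\<dots> = s\<^sup>2 - 2 * s * c + r\<^sup>2"
            using True by (simp flip: cmod_power2)
          finally show ?thesis .
        qed
        have "0 \<le> (\<rho> k - \<rho> (Suc k)) * (\<rho> k + \<rho> (Suc k) - 2 * c)"
          using \<rho>(2)[of k] \<rho>(1)[of k] \<rho>(1)[of "Suc k"] \<open>\<bar>c\<bar> \<le> r\<close> by (intro mult_nonneg_nonneg) auto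
        then show "(cmod (complex_of_real (\<rho> (Suc k)) * cis t - a))\<^sup>2 \<le> (cmod (complex_of_real (\<rho> k) * cis t - a))\<^sup>2"
          unfolding e by (simp add: algebra_simps power2_eq_square)
      qed simp
      then show ?thesis using nz[of "Suc k" t] nz[of k t] by (auto simp: f_def)
    qed
    show "(\<lambda>k. f k t) \<longlonglongrightarrow> g t" if "t \<in> {0..2*pi}" for t
    proof (cases "t \<in> S")
      case True
      then show ?thesis by (simp add: f_def g_def)
    next
      case False
      then have "complex_of_real r * cis t - a \<noteq> 0" using that by (auto simp: S_def)
      then have "(\<lambda>k. ln (cmod (complex_of_real (\<rho> k) * cis t - a))) \<longlonglongrightarrow> ln (cmod (complex_of_real r * cis t - a))"
        by (intro tendsto_intros \<rho>lim) auto
      then show ?thesis using False by (simp add: f_def g_def)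
    qed
    have "(\<lambda>k. 2 * pi * ln (\<rho> k)) \<longlonglongrightarrow> 2 * pi * ln r"
      using assms by (intro tendsto_intros \<rho>lim) auto
    then have "bounded (range (\<lambda>k. 2 * pi * ln (\<rho> k)))"
      by (rule convergent_imp_bounded)
    then show "bounded (range (\<lambda>k. integral {0..2*pi} (f k)))"
      by (simp add: integral_unique[OF int])
  qed
  then have "g integrable_on {0..2*pi}" by blast
  then show ?thesis
    by (rule integrable_spike_finite[OF finS, rotated]) (auto simp: g_def)
qed

section \<open>Zeros of holomorphic functions on compact sets\<close>

lemma finite_zeros_compact:
  fixes f :: "complex \<Rightarrow> complex"
  assumes "f holomorphic_on S" "open S" "connected S" "compact K" "K \<subseteq> S" "\<exists>z\<in>S. f z \<noteq> 0"
  shows "finite {z\<in>K. f z = 0}"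
proof (cases "f constant_on S")
  case True
  then obtain c where "\<forall>z\<in>S. f z = c" by (auto simp: constant_on_def)
  then have "{z\<in>K. f z = 0} = {}" using assms(5,6) by force
  then show ?thesis by (simp only: finite.emptyI)
next
  case False
  then show ?thesis using holomorphic_compact_finite_zeros assms by blast
qed

text \<open>The local cofactor at \<open>a\<close> and the quotient \<open>f z / (z - a) ^ n\<close>
  away from \<open>a\<close> agree on the overlap, so they glue to a cofactor on all of
  \<open>S\<close>.\<close>

lemma holomorphic_factor_zero_global:
  fixes f :: "complex \<Rightarrow> complex"
  assumes "f holomorphic_on S" "open S" "connected S" "a \<in> S" "f a = 0" "\<exists>z\<in>S. f z \<noteq> 0"
  obtains q n where "0 < (n::nat)" "q holomorphic_on S" "q a \<noteq> 0" "\<And>z. z \<in> S \<Longrightarrow> f z = (z - a) ^ n * q z"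
proof -
  have "\<not> f constant_on S" using assms(4-6) unfolding constant_on_def by metis
  then obtain g r n where g: "0 < (n::nat)" "0 < r" "ball a r \<subseteq> S" "g holomorphic_on ball a r"
      "\<And>w. w \<in> ball a r \<Longrightarrow> f w = (w - a) ^ n * g w" "\<And>w. w \<in> ball a r \<Longrightarrow> g w \<noteq> 0"
    using holomorphic_factor_zero_nonconstant[OF assms(1-5)] by metis
  define q where "q z = (if z = a then g a else f z / (z - a) ^ n)" for z
  have qg: "q z = g z" if "z \<in> ball a r" for z
    using g(5)[OF that] by (auto simp: q_def)
  have "q holomorphic_on (S - {a}) \<union> ball a r"
  proof (rule holomorphic_on_Un)
    have "(\<lambda>z. f z / (z - a) ^ n) holomorphic_on S - {a}"
      using assms(1) by (intro holomorphic_intros) (auto intro: holomorphic_on_subset)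
    then show "q holomorphic_on S - {a}"
      by (rule holomorphic_transform) (auto simp: q_def)
    show "q holomorphic_on ball a r"
      using g(4) by (rule holomorphic_transform) (simp add: qg)
  qed (use assms in auto)
  moreover have "(S - {a}) \<union> ball a r = S" using g(2,3) assms(4) by auto
  ultimately have "q holomorphic_on S" by simp
  moreover have "q a \<noteq> 0" using qg[of a] g(2) g(6)[of a] by simp
  moreover have "f z = (z - a) ^ n * q z" for z
    using assms(5) g(1) by (auto simp: q_def)
  ultimately show ?thesis using that g(1) by blast
qed

text \<open>Induction on the number of distinct zeros in \<open>K\<close>: dividing out one zero
  with its full multiplicity lowers that number by one. With \<open>K\<close> a circle it yields
  integrability of the logarithm, with \<open>K\<close> a closed disc the outer part.\<close>

lemma holomorphic_divide_zeros_induct: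
  fixes f :: "complex \<Rightarrow> complex"
  assumes f: "f holomorphic_on S" "\<exists>z\<in>S. f z \<noteq> 0"
    and S: "open S" "connected S" "compact K" "K \<subseteq> S"
    and base: "\<And>g. g holomorphic_on S \<Longrightarrow> \<forall>z\<in>K. g z \<noteq> 0 \<Longrightarrow> P g"
    and step: "\<And>g q a n. g holomorphic_on S \<Longrightarrow> q holomorphic_on S \<Longrightarrow> \<exists>z\<in>S. q z \<noteq> 0 \<Longrightarrow> a \<in> K \<Longrightarrow> 0 < (n::nat)
        \<Longrightarrow> \<forall>z\<in>S. g z = (z - a) ^ n * q z \<Longrightarrow> P q \<Longrightarrow> P g"
  shows "P f"
  using f
proof (induction "card {z\<in>K. f z = 0}" arbitrary: f rule: less_induct)
  case (less f)
  show ?case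
  proof (cases "\<forall>z\<in>K. f z \<noteq> 0")
    case True
    then show ?thesis using base less.prems by blast
  next
    case False
    then obtain a where a: "a \<in> K" "f a = 0" by blast
    then have "a \<in> S" using S by blast
    then obtain q n where q: "0 < (n::nat)" "q holomorphic_on S" "q a \<noteq> 0" "\<And>z. z \<in> S \<Longrightarrow> f z = (z - a) ^ n * q z"
      using holomorphic_factor_zero_global less.prems S a by metis
    have "{z\<in>K. q z = 0} \<subset> {z\<in>K. f z = 0}"
      using a q S(4) by auto
    moreover have "finite {z\<in>K. f z = 0}" using finite_zeros_compact less.prems S by blast
    ultimately have "card {z\<in>K. q z = 0} < card {z\<in>K. f z = 0}" by (rule psubset_card_mono[rotated])
    moreover have "\<exists>z\<in>S. q z \<noteq> 0" using \<open>a \<in> S\<close> q(3) by blast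
    ultimately have "P q" using less.hyps q(2) by blast
    then show ?thesis using step less.prems(1) q a \<open>\<exists>z\<in>S. q z \<noteq> 0\<close> by blast
  qed
qed

lemma integrable_ln_circle:
  assumes "m holomorphic_on ball 0 1" "\<exists>z\<in>ball 0 1. m z \<noteq> 0" "0 < r" "r < 1"
  shows "(\<lambda>t. ln (cmod (m (complex_of_real r * cis t)))) integrable_on {0..2*pi}"
proof (rule holomorphic_divide_zeros_induct[OF assms(1,2), of "sphere 0 r"])
  show "sphere 0 r \<subseteq> ball (0::complex) 1" using assms by auto
next
  fix g :: "complex \<Rightarrow> complex"
  assume g: "g holomorphic_on ball 0 1" "\<forall>z\<in>sphere 0 r. g z \<noteq> 0"
  have "continuous_on {0..2*pi} (g \<circ> (\<lambda>t. complex_of_real r * cis t))"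
    using assms g by (intro continuous_on_compose continuous_intros
      continuous_on_subset[OF holomorphic_on_imp_continuous_on[OF g(1)]]) (auto simp: norm_mult)
  moreover have "g (complex_of_real r * cis t) \<noteq> 0" for t
    using g assms by (auto simp: norm_mult)
  ultimately show "(\<lambda>t. ln (cmod (g (complex_of_real r * cis t)))) integrable_on {0..2*pi}"
    by (intro integrable_continuous_real continuous_intros) (auto simp: o_def)
next
  fix g q :: "complex \<Rightarrow> complex" and a :: complex and n :: nat
  assume q: "q holomorphic_on ball 0 1" "\<exists>z\<in>ball 0 1. q z \<noteq> 0" and a: "a \<in> sphere 0 r"
    and n: "0 < n" and g: "\<forall>z\<in>ball 0 1. g z = (z - a) ^ n * q z"
    and int: "(\<lambda>t. ln (cmod (q (complex_of_real r * cis t)))) integrable_on {0..2*pi}"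
  \<comment> \<open>At a zero, \<open>ln 0 = 0\<close> breaks the rule for the logarithm of a
    product, so that rule is applied only off finitely many parameters.\<close>
  define Z where "Z = insert a {z\<in>sphere 0 r. q z = 0}"
  have "finite {z\<in>sphere 0 r. q z = 0}"
    using assms q by (intro finite_zeros_compact[of q "ball 0 1"]) auto
  then have fin: "finite {t\<in>{0..2*pi}. complex_of_real r * cis t \<in> Z}"
    using assms by (intro finite_circle_preimage) (auto simp: Z_def)
  have int': "(\<lambda>t. real n * ln (cmod (complex_of_real r * cis t - a)) + ln (cmod (q (complex_of_real r * cis t))))
      integrable_on {0..2*pi}"
    using int integrable_ln_circle_linear[OF assms(3), of a]
    by (intro integrable_add integrable_on_mult_right)
  have "ln (cmod (g (complex_of_real r * cis t))) =
      real n * ln (cmod (complex_of_real r * cis t - a)) + ln (cmod (q (complex_of_real r * cis t)))"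
    if "t \<in> {0..2*pi} - {t\<in>{0..2*pi}. complex_of_real r * cis t \<in> Z}" for t
  proof -
    have "complex_of_real r * cis t \<noteq> a" "q (complex_of_real r * cis t) \<noteq> 0"
      using that assms by (auto simp: Z_def norm_mult)
    then show ?thesis using g assms by (simp add: norm_mult norm_power ln_mult ln_realpow)
  qed
  then show "(\<lambda>t. ln (cmod (g (complex_of_real r * cis t)))) integrable_on {0..2*pi}"
    by (rule integrable_spike_finite[OF fin _ int'])
qed auto

text \<open>The outer part of \<^term>\<open>m\<close> on the disc of radius \<^term>\<open>r\<close>: each factor \<^term>\<open>z - a\<close> with a zero
  \<^term>\<open>a\<close> inside is traded for \<^term>\<open>r - cnj a * z / r\<close>, which has the same modulus on the circle
  and no zero inside.\<close>
lemma outer_logarithm_exists: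
  assumes "m holomorphic_on ball 0 1" "0 < r" "r < 1" "\<forall>z\<in>sphere 0 r. m z \<noteq> 0"
  shows "\<exists>H R. r < R \<and> R \<le> 1 \<and> H holomorphic_on ball 0 R \<and>
    (\<forall>z. cmod z = r \<longrightarrow> cmod (m z) = exp (Re (H z)))"
proof -
  \<comment> \<open>Zero-freeness of the circle is a premise inside \<open>P\<close>, since each
    quotient in the induction inherits it from the function above it.\<close>
  define P where "P g \<longleftrightarrow> (\<forall>z\<in>sphere 0 r. g z \<noteq> 0) \<longrightarrow>
    (\<exists>E. E holomorphic_on ball 0 1 \<and> (\<forall>z\<in>cball 0 r. E z \<noteq> 0) \<and> (\<forall>z\<in>sphere 0 r. cmod (g z) = cmod (E z)))"
    for g :: "complex \<Rightarrow> complex"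
  have "complex_of_real r \<in> sphere 0 r" using assms by auto
  then have nz: "\<exists>z\<in>ball 0 1. m z \<noteq> 0" using assms by (intro bexI[of _ "complex_of_real r"]) auto
  have "P m"
  proof (rule holomorphic_divide_zeros_induct[OF assms(1) nz, of "cball 0 r"])
    fix g :: "complex \<Rightarrow> complex"
    assume "g holomorphic_on ball 0 1" "\<forall>z\<in>cball 0 r. g z \<noteq> 0"
    then show "P g" by (auto simp: P_def)
  next
    fix g q :: "complex \<Rightarrow> complex" and a :: complex and n :: nat
    assume a: "a \<in> cball 0 r" and n: "0 < n" and g: "\<forall>z\<in>ball 0 1. g z = (z - a) ^ n * q z" and q: "P q"
    show "P g"
      unfolding P_def
    proof
      assume gnz: "\<forall>z\<in>sphere 0 r. g z \<noteq> 0"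
      have sph: "z \<in> ball 0 1" if "z \<in> sphere 0 r" for z :: complex using that assms by auto
      have "\<forall>z\<in>sphere 0 r. q z \<noteq> 0" using gnz g sph by force
      with q obtain E where E: "E holomorphic_on ball 0 1" "\<forall>z\<in>cball 0 r. E z \<noteq> 0"
          "\<forall>z\<in>sphere 0 r. cmod (q z) = cmod (E z)"
        by (auto simp: P_def)
      have "a \<notin> sphere 0 r" using gnz g sph n by force
      then have ar: "cmod a < r" using a by auto
      define E' where "E' z = (complex_of_real r - cnj a * z / r) ^ n * E z" for z
      have "E' holomorphic_on ball 0 1" unfolding E'_def
        using assms by (intro holomorphic_intros E(1)) auto
      moreover have "E' z \<noteq> 0" if "z \<in> cball 0 r" for z
      proof -
        have "cmod (cnj a * z / r) = cmod a * (cmod z / r)" using assms by (simp add: norm_mult norm_divide)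
        also have "\<dots> \<le> cmod a * 1" using that assms by (intro mult_left_mono) auto
        also have "\<dots> < r" using ar by simp
        finally have "complex_of_real r \<noteq> cnj a * z / r"
          using assms by (metis abs_of_pos less_irrefl norm_of_real)
        then show ?thesis using that E(2) by (auto simp: E'_def)
      qed
      moreover have "cmod (g z) = cmod (E' z)" if z: "z \<in> sphere 0 r" for z
      proof -
        \<comment> \<open>On the circle \<open>cnj z\<close> is \<open>r\<^sup>2 / z\<close>, which
          turns the conjugate of \<open>z - a\<close> into a multiple of the reflected
          factor.\<close>
        have "z * cnj z = complex_of_real r ^ 2" using z by (simp add: complex_norm_square[symmetric])
        then have "z * cnj (z - a) = r * (complex_of_real r - cnj a * z / r)"
          using assms by (simp add: algebra_simps power2_eq_square)
        then have "cmod z * cmod (z - a) = cmod (r * (complex_of_real r - cnj a * z / r))"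
          by (metis complex_mod_cnj norm_mult)
        then have "cmod (z - a) = cmod (complex_of_real r - cnj a * z / r)"
          using z assms by (simp add: norm_mult)
        then show ?thesis using g sph[OF z] E(3) z by (simp add: E'_def norm_mult norm_power)
      qed
      ultimately show "\<exists>E. E holomorphic_on ball 0 1 \<and> (\<forall>z\<in>cball 0 r. E z \<noteq> 0) \<and>
          (\<forall>z\<in>sphere 0 r. cmod (g z) = cmod (E z))" by blast
    qed
  qed (use assms in auto)
  then obtain E where E: "E holomorphic_on ball 0 1" "\<forall>z\<in>cball 0 r. E z \<noteq> 0"
      "\<forall>z\<in>sphere 0 r. cmod (m z) = cmod (E z)"
    using assms(4) by (auto simp: P_def)
  \<comment> \<open>\<open>E\<close> has no zero on the compact disc, hence none on a slightly
    larger open disc; this gives a logarithm that is holomorphic past the circle.\<close>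
  define B where "B = ball 0 1 \<inter> E -` (- {0})"
  have "open B" unfolding B_def
    using E(1) by (intro continuous_open_preimage holomorphic_on_imp_continuous_on) auto
  moreover have "cball 0 r \<subseteq> B" using E(2) assms by (auto simp: B_def)
  ultimately obtain e where e: "e > 0" "(\<Union>x\<in>cball 0 r. ball x e) \<subseteq> B"
    using compact_subset_open_imp_ball_epsilon_subset[of "cball 0 r" B] by auto
  define R where "R = min 1 (r + e)"
  have "ball 0 R \<subseteq> B"
  proof
    fix z :: complex assume z: "z \<in> ball 0 R"
    show "z \<in> B"
    proof (cases "z \<in> cball 0 r")
      case True then show ?thesis using \<open>cball 0 r \<subseteq> B\<close> by blast
    next
      case False
      \<comment> \<open>The radial projection of \<open>z\<close> to the circle, at distance
        \<open>cmod z - r < e\<close> from \<open>z\<close>.\<close>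
      define w where "w = complex_of_real (r / cmod z) * z"
      have "cmod z > 0" using False assms unfolding mem_cball dist_0_norm by linarith
      then have z0: "z \<noteq> 0" by simp
      then have "cmod w = r" unfolding w_def norm_mult norm_of_real using assms by simp
      moreover have "dist w z < e"
      proof -
        have "dist w z = cmod (complex_of_real (1 - r / cmod z) * z)"
          by (simp add: w_def dist_norm norm_minus_commute algebra_simps)
        also have "\<dots> = (1 - r / cmod z) * cmod z"
          using False assms z0 by (simp only: norm_mult norm_of_real) (simp add: field_simps)
        also have "\<dots> = cmod z - r" using z0 by (simp add: field_simps)
        finally show ?thesis using z by (simp add: R_def)
      qed
      ultimately show ?thesis using e(2) by force
    qed
  qed
  then have "E holomorphic_on ball 0 R" "\<And>z. z \<in> ball 0 R \<Longrightarrow> E z \<noteq> 0"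
    using E(1) by (auto simp: B_def R_def intro: holomorphic_on_subset)
  then obtain H where H: "H holomorphic_on ball 0 R" "\<And>z. z \<in> ball 0 R \<Longrightarrow> E z = exp (H z)"
    using contractible_imp_holomorphic_log[of E "ball 0 R"] convex_imp_contractible[OF convex_ball] by blast
  have "r < R" "R \<le> 1" using e assms by (auto simp: R_def)
  moreover have "cmod (m z) = exp (Re (H z))" if "cmod z = r" for z
    using E(3) that H(2)[of z] \<open>r < R\<close> by simp
  ultimately show ?thesis using H(1) by blast
qed

section \<open>The means \<open>M_r\<close> as values of outer functions, and their growth in the
  radius\<close>

lemma Re_circle_mean_value:
  assumes "H holomorphic_on ball 0 R" and "0 < r" "r < R"
  shows "((\<lambda>t. Re (H (complex_of_real r * cis t))) has_integral (2 * pi * Re (H 0))) {0..2*pi}"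
  using has_integral_linear[OF circle_mean_value[OF assms] bounded_linear_Re] by (simp add: o_def)

lemma M_r_eq_exp_outer:
  assumes "0 < r" "r < 1" "r < R" "H holomorphic_on ball 0 R"
    and eq: "\<And>z. cmod z = r \<Longrightarrow> cmod (m z) = exp (Re (H z))"
  shows "M_r m r = exp (Re (H 0))"
proof -
  have "cmod (m (complex_of_real r)) \<noteq> 0" using eq[of "complex_of_real r"] assms by simp
  moreover have "complex_of_real r \<in> ball 0 1" using assms by simp
  ultimately have nz: "\<not> (\<forall>z\<in>ball 0 1. m z = 0)" by fastforce
  have "ln (cmod (m (complex_of_real r * cis t))) = Re (H (complex_of_real r * cis t))" for t
    using eq[of "complex_of_real r * cis t"] assms by (simp add: norm_mult)
  then have "integral {0..2*pi} (\<lambda>t. ln (cmod (m (complex_of_real r * cis t)))) = 2 * pi * Re (H 0)"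
    using Re_circle_mean_value[OF assms(4,1,3)] by (simp add: integral_unique)
  then show ?thesis using nz by (simp add: M_r_def)
qed

text \<open>With \<open>H\<close> the outer logarithm for the radius \<open>r'\<close>, the function
  \<open>m * exp (- H)\<close> has modulus 1 on that circle, so by the maximum principle
  \<open>cmod m \<le> exp (Re H)\<close> inside. Averaging over the smaller circle, which may carry
  zeros of \<open>m\<close>, gives at most \<open>Re (H 0)\<close>.\<close>

lemma M_r_le_M_r:
  assumes m: "m holomorphic_on ball 0 1" "\<exists>z\<in>ball 0 1. m z \<noteq> 0"
    and r: "0 < r" "r \<le> r'" "r' < 1" and nz: "\<forall>z\<in>sphere 0 r'. m z \<noteq> 0"
  shows "M_r m r \<le> M_r m r'"
proof -
  have r': "0 < r'" using r by simp
  obtain H R where H: "r' < R" "R \<le> 1" "H holomorphic_on ball 0 R"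
    "\<And>z. cmod z = r' \<Longrightarrow> cmod (m z) = exp (Re (H z))"
    using outer_logarithm_exists[OF m(1) r' r(3) nz] by blast
  have le: "cmod (m z) \<le> exp (Re (H z))" if "z \<in> cball 0 r'" for z
  proof -
    have "m holomorphic_on ball 0 R" using H(2) by (intro holomorphic_on_subset[OF m(1)]) auto
    then have hol: "(\<lambda>z. m z * exp (- H z)) holomorphic_on ball 0 R"
      using H(3) by (intro holomorphic_on_mult holomorphic_on_exp' holomorphic_on_minus)
    have "cmod (m z * exp (- H z)) \<le> 1"
    proof (rule maximum_modulus_frontier[of "\<lambda>z. m z * exp (- H z)" "cball 0 r'"])
      show "(\<lambda>z. m z * exp (- H z)) holomorphic_on interior (cball 0 r')"
        using H(1) by (intro holomorphic_on_subset[OF hol]) auto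
      show "continuous_on (closure (cball 0 r')) (\<lambda>z. m z * exp (- H z))"
        using H(1) by (intro holomorphic_on_imp_continuous_on holomorphic_on_subset[OF hol]) auto
      show "cmod (m z * exp (- H z)) \<le> 1" if "z \<in> frontier (cball 0 r')" for z :: complex
      proof -
        have "cmod z = r'" using that r' by simp
        then show ?thesis unfolding norm_mult norm_exp_eq_Re H(4)[OF \<open>cmod z = r'\<close>]
          by (simp flip: exp_add)
      qed
    qed (use that in auto)
    then show ?thesis unfolding norm_mult norm_exp_eq_Re by (simp add: exp_minus field_simps)
  qed
  define Z where "Z = {z\<in>sphere 0 r. m z = 0}"
  have "finite Z" unfolding Z_def using m r by (intro finite_zeros_compact[of m "ball 0 1"]) auto
  then have fin: "finite {t\<in>{0..2*pi}. complex_of_real r * cis t \<in> Z}"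
    using r by (intro finite_circle_preimage) auto
  \<comment> \<open>At zeros of \<open>m\<close> the default \<open>ln 0 = 0\<close> could exceed
    \<open>Re H\<close>; replacing it there by \<open>Re H\<close> makes the comparison hold
    pointwise.\<close>
  define f where "f t = (if complex_of_real r * cis t \<in> Z then Re (H (complex_of_real r * cis t))
     else ln (cmod (m (complex_of_real r * cis t))))" for t
  let ?I = "integral {0..2*pi} (\<lambda>t. ln (cmod (m (complex_of_real r * cis t))))"
  have "((\<lambda>t. ln (cmod (m (complex_of_real r * cis t)))) has_integral ?I) {0..2*pi}"
    using integrable_ln_circle[OF m, of r] r by (simp add: has_integral_integral)
  then have "(f has_integral ?I) {0..2*pi}"
    by (rule has_integral_spike_finite[OF fin, rotated]) (auto simp: f_def)
  moreover have "((\<lambda>t. Re (H (complex_of_real r * cis t))) has_integral (2 * pi * Re (H 0))) {0..2*pi}"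
    using Re_circle_mean_value[OF H(3)] H(1) r by simp
  moreover have "f t \<le> Re (H (complex_of_real r * cis t))" for t
  proof (cases "complex_of_real r * cis t \<in> Z")
    case False
    then have "cmod (m (complex_of_real r * cis t)) > 0" using r by (auto simp: Z_def norm_mult)
    moreover have "cmod (m (complex_of_real r * cis t)) \<le> exp (Re (H (complex_of_real r * cis t)))"
      using r by (intro le) (auto simp: norm_mult)
    ultimately have "ln (cmod (m (complex_of_real r * cis t))) \<le> Re (H (complex_of_real r * cis t))"
      by (metis exp_gt_zero ln_exp ln_le_cancel_iff)
    then show ?thesis using False by (simp add: f_def)
  qed (simp add: f_def)
  ultimately have "?I \<le> 2 * pi * Re (H 0)" by (rule has_integral_le) 
  then have "M_r m r \<le> exp (Re (H 0))" using m(2) by (auto simp: M_r_def field_simps)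
  also have "\<dots> = M_r m r'" using M_r_eq_exp_outer[of r' R H m] H r by simp
  finally show ?thesis .
qed

text \<open>The finitely many zeros in a closed disc have finitely many moduli, which cannot fill an
  interval of radii.\<close>

lemma exists_zero_free_circle:
  assumes "m holomorphic_on ball 0 1" "\<exists>z\<in>ball 0 1. m z \<noteq> 0" "s < 1"
  obtains r where "s < r" "0 < r" "r < 1" "\<forall>z\<in>sphere 0 r. m z \<noteq> 0"
proof -
  define s' where "s' = (max 0 s + 1) / 2"
  have s': "max 0 s < s'" "s' < 1" using assms(3) by (auto simp: s'_def)
  have "finite {z\<in>cball 0 s'. m z = 0}"
    using assms s' by (intro finite_zeros_compact[of m "ball 0 1"]) auto
  then have "finite (cmod ` {z\<in>cball 0 s'. m z = 0})" by simp
  moreover have "infinite {max 0 s<..<s'}" using s' by simp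
  ultimately have "\<not> {max 0 s<..<s'} \<subseteq> cmod ` {z\<in>cball 0 s'. m z = 0}" using finite_subset by blast
  then obtain r where "r \<in> {max 0 s<..<s'}" "r \<notin> cmod ` {z\<in>cball 0 s'. m z = 0}" by blast
  then show ?thesis using s' by (intro that[of r]) auto
qed

section \<open>Growth of the cocycle over the rotation\<close>

text \<open>Uniform equidistribution by hand: \<open>H\<close> is a Taylor polynomial plus a tail
  below \<open>\<epsilon>\<close>. The tail costs \<open>\<epsilon> * n\<close>. A monomial of
  degree \<open>j \<ge> 1\<close> gives a geometric sum bounded by
  \<open>2 / cmod (\<beta> ^ j - 1)\<close>, finite because \<open>\<beta>\<close> is not a root of
  unity.\<close>

lemma birkhoff_sum_bound:
  fixes H :: "complex \<Rightarrow> complex"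
  assumes H: "H holomorphic_on ball 0 R" and r: "0 < r" "r < R"
    and \<beta>: "cmod \<beta> = 1" "\<forall>n::nat. n \<ge> 1 \<longrightarrow> \<beta> ^ n \<noteq> 1" and "\<epsilon> > 0"
  shows "\<exists>C. \<forall>n z. cmod z \<le> r \<longrightarrow>
    cmod ((\<Sum>k<n. H (\<beta> ^ k * z)) - of_nat n * H 0) \<le> \<epsilon> * real n + C"
proof -
  define a where "a j = (deriv ^^ j) H 0 / fact j" for j
  have sums: "(\<lambda>j. a j * z ^ j) sums H z" if "cmod z < R" for z
    using holomorphic_power_series[OF H, of z] that by (simp add: a_def)
  \<comment> \<open>Convergence at a radius strictly beyond \<open>r\<close> gives absolute
    convergence at \<open>r\<close>.\<close>
  define x where "x = (r + R) / 2"
  have x: "r < x" "x < R" using r by (auto simp: x_def)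
  then have "summable (\<lambda>j. a j * complex_of_real x ^ j)"
    using sums[of "complex_of_real x"] r by (auto simp: sums_iff)
  then have summ: "summable (\<lambda>j. norm (a j * complex_of_real r ^ j))"
    by (rule powser_insidea) (use r x in auto)
  have "\<exists>N. \<forall>n\<ge>N. norm (\<Sum>i. norm (a (i + n) * complex_of_real r ^ (i + n))) < \<epsilon>"
    using suminf_exist_split[OF \<open>\<epsilon> > 0\<close> summ] .
  then obtain N0 where N0: "\<And>n. n \<ge> N0 \<Longrightarrow> norm (\<Sum>i. norm (a (i + n) * complex_of_real r ^ (i + n))) < \<epsilon>"
    by blast
  \<comment> \<open>The successor puts the constant term \<open>H 0\<close> into the polynomial,
    where it cancels.\<close>
  define N where "N = Suc N0"
  define p where "p z = (\<Sum>j<N. a j * z ^ j)" for z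
  have tail: "cmod (H z - p z) \<le> \<epsilon>" if z: "cmod z \<le> r" for z
  proof -
    have "H z - p z = (\<Sum>i. a (i + N) * z ^ (i + N))"
      using suminf_minus_initial_segment[of "\<lambda>j. a j * z ^ j" N] sums[of z] z r
      by (simp add: p_def sums_iff)
    also have "cmod \<dots> \<le> (\<Sum>i. norm (a (i + N) * complex_of_real r ^ (i + N)))"
    proof (rule norm_suminf_le)
      show "cmod (a (i + N) * z ^ (i + N)) \<le> norm (a (i + N) * complex_of_real r ^ (i + N))" for i
        using z r by (auto simp: norm_mult norm_power intro!: mult_left_mono power_mono)
      show "summable (\<lambda>i. norm (a (i + N) * complex_of_real r ^ (i + N)))"
        using summable_ignore_initial_segment[OF summ, of N] .
    qed
    also have "\<dots> \<le> \<epsilon>" using N0[of N] by (simp add: N_def)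
    finally show ?thesis .
  qed
  define C where "C = (\<Sum>j=1..<N. cmod (a j) * r ^ j * (2 / cmod (\<beta> ^ j - 1)))"
  have "cmod ((\<Sum>k<n. H (\<beta> ^ k * z)) - of_nat n * H 0) \<le> \<epsilon> * real n + C" if z: "cmod z \<le> r" for n z
  proof -
    have "H 0 = a 0" by (simp add: a_def)
    have p: "p y - H 0 = (\<Sum>j=1..<N. a j * y ^ j)" for y
    proof -
      have "{..<N} = insert 0 {1..<N}" by (auto simp: N_def)
      then show ?thesis using \<open>H 0 = a 0\<close> by (simp add: p_def)
    qed
    have "(\<Sum>k<n. H (\<beta> ^ k * z)) - of_nat n * H 0
      = (\<Sum>k<n. (H (\<beta> ^ k * z) - p (\<beta> ^ k * z)) + (p (\<beta> ^ k * z) - H 0))"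
      by (simp add: sum_subtractf)
    also have "\<dots> = (\<Sum>k<n. H (\<beta> ^ k * z) - p (\<beta> ^ k * z)) + (\<Sum>k<n. \<Sum>j=1..<N. a j * (\<beta> ^ k * z) ^ j)"
      unfolding p by (simp only: sum.distrib)
    also have "(\<Sum>k<n. \<Sum>j=1..<N. a j * (\<beta> ^ k * z) ^ j) = (\<Sum>j=1..<N. a j * z ^ j * (\<Sum>k<n. (\<beta> ^ j) ^ k))"
      by (subst sum.swap) (simp add: sum_distrib_left power_mult_distrib mult_ac flip: power_mult)
    finally have eq: "(\<Sum>k<n. H (\<beta> ^ k * z)) - of_nat n * H 0 =
      (\<Sum>k<n. H (\<beta> ^ k * z) - p (\<beta> ^ k * z)) + (\<Sum>j=1..<N. a j * z ^ j * (\<Sum>k<n. (\<beta> ^ j) ^ k))" .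
    have 1: "cmod (\<Sum>k<n. H (\<beta> ^ k * z) - p (\<beta> ^ k * z)) \<le> (\<Sum>k<n. \<epsilon>)"
      by (rule sum_norm_le) (use tail z \<beta> in \<open>auto simp: norm_mult norm_power\<close>)
    have 2: "cmod (\<Sum>j=1..<N. a j * z ^ j * (\<Sum>k<n. (\<beta> ^ j) ^ k)) \<le> C"
      unfolding C_def
    proof (rule sum_norm_le)
      fix j assume "j \<in> {1..<N}"
      then have "\<beta> ^ j \<noteq> 1" using \<beta> by auto
      have "cmod (\<Sum>k<n. (\<beta> ^ j) ^ k) = cmod ((\<beta> ^ j) ^ n - 1) / cmod (\<beta> ^ j - 1)"
        using geometric_sum[OF \<open>\<beta> ^ j \<noteq> 1\<close>, of n] by (simp add: norm_divide)
      also have "\<dots> \<le> 2 / cmod (\<beta> ^ j - 1)"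
      proof (rule divide_right_mono)
        show "cmod ((\<beta> ^ j) ^ n - 1) \<le> 2"
          using norm_triangle_ineq4[of "(\<beta> ^ j) ^ n" 1] \<beta>(1) by (simp add: norm_power)
      qed simp
      finally have "cmod (\<Sum>k<n. (\<beta> ^ j) ^ k) \<le> 2 / cmod (\<beta> ^ j - 1)" .
      then show "cmod (a j * z ^ j * (\<Sum>k<n. (\<beta> ^ j) ^ k)) \<le> cmod (a j) * r ^ j * (2 / cmod (\<beta> ^ j - 1))"
        unfolding norm_mult norm_power using z r by (intro mult_mono mult_nonneg_nonneg power_mono) auto
    qed
    show ?thesis
      unfolding eq using norm_triangle_mono[OF 1 2] by (simp add: mult.commute)
  qed
  then show ?thesis by blast
qed

text \<open>The weight of the iterates: \<open>T ^ n\<close> sends \<open>f\<close> to the function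
  with value \<open>rotation_cocycle m \<beta> n z * f (\<beta> ^ n * z)\<close> at
  \<open>z\<close>.\<close>

definition rotation_cocycle :: "(complex \<Rightarrow> complex) \<Rightarrow> complex \<Rightarrow> nat \<Rightarrow> complex \<Rightarrow> complex" where
  "rotation_cocycle m \<beta> n z = (\<Prod>k<n. m (\<beta> ^ k * z))"

text \<open>The circle is invariant under the rotation, so the modulus of the cocycle there is the
  exponential of a Birkhoff sum of \<open>Re H\<close>, and
  \<open>M_r m r = exp (Re (H 0))\<close>.\<close>

lemma rotation_cocycle_circle_bounds:
  assumes m: "m holomorphic_on ball 0 1" and r: "0 < r" "r < 1" and nz: "\<forall>z\<in>sphere 0 r. m z \<noteq> 0"
    and \<beta>: "cmod \<beta> = 1" "\<forall>n::nat. n \<ge> 1 \<longrightarrow> \<beta> ^ n \<noteq> 1" and "\<epsilon> > 0"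
  shows "\<exists>C>0. \<forall>n z. cmod z = r \<longrightarrow> cmod (rotation_cocycle m \<beta> n z) \<le> C * (M_r m r * exp \<epsilon>) ^ n
    \<and> (M_r m r * exp (- \<epsilon>)) ^ n \<le> C * cmod (rotation_cocycle m \<beta> n z)"
proof -
  obtain H R where H: "r < R" "R \<le> 1" "H holomorphic_on ball 0 R"
    "\<And>z. cmod z = r \<Longrightarrow> cmod (m z) = exp (Re (H z))"
    using outer_logarithm_exists[OF m r nz] by blast
  have M: "M_r m r = exp (Re (H 0))" by (rule M_r_eq_exp_outer[OF r H(1,3,4)])
  obtain C where C: "\<And>n z. cmod z \<le> r \<Longrightarrow>
    cmod ((\<Sum>k<n. H (\<beta> ^ k * z)) - of_nat n * H 0) \<le> \<epsilon> * real n + C"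
    using birkhoff_sum_bound[OF H(3) r(1) H(1) \<beta> \<open>\<epsilon> > 0\<close>] by blast
  have w: "cmod (rotation_cocycle m \<beta> n z) = exp (\<Sum>k<n. Re (H (\<beta> ^ k * z)))" if "cmod z = r" for n z
  proof -
    have "cmod (m (\<beta> ^ k * z)) = exp (Re (H (\<beta> ^ k * z)))" for k
      using that \<beta> by (intro H(4)) (simp add: norm_mult norm_power)
    then show ?thesis by (simp add: rotation_cocycle_def exp_sum flip: prod_norm)
  qed
  have b: "\<bar>(\<Sum>k<n. Re (H (\<beta> ^ k * z))) - real n * Re (H 0)\<bar> \<le> \<epsilon> * real n + C" if "cmod z = r" for n z
  proof -
    have "(\<Sum>k<n. Re (H (\<beta> ^ k * z))) - real n * Re (H 0) = Re ((\<Sum>k<n. H (\<beta> ^ k * z)) - of_nat n * H 0)"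
      by simp
    then show ?thesis using C[of z n] abs_Re_le_cmod[of "(\<Sum>k<n. H (\<beta> ^ k * z)) - of_nat n * H 0"] that
      by linarith
  qed
  show ?thesis
  proof (intro exI[of _ "exp C"] conjI allI impI)
    show "exp C > 0" by simp
    fix n z assume z: "cmod z = r"
    have "(\<Sum>k<n. Re (H (\<beta> ^ k * z))) \<le> C + real n * (Re (H 0) + \<epsilon>)"
      using b[OF z, of n] by (simp add: algebra_simps abs_le_iff)
    then show "cmod (rotation_cocycle m \<beta> n z) \<le> exp C * (M_r m r * exp \<epsilon>) ^ n"
      unfolding w[OF z] M by (simp flip: exp_add exp_of_nat_mult)
    have "real n * (Re (H 0) - \<epsilon>) \<le> C + (\<Sum>k<n. Re (H (\<beta> ^ k * z)))"
      using b[OF z, of n] by (simp add: algebra_simps abs_le_iff)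
    then show "(M_r m r * exp (- \<epsilon>)) ^ n \<le> exp C * cmod (rotation_cocycle m \<beta> n z)"
      unfolding w[OF z] M by (simp flip: exp_add exp_of_nat_mult)
  qed
qed

lemma rotation_cocycle_holomorphic:
  assumes "m holomorphic_on ball 0 1" "cmod \<beta> = 1"
  shows "rotation_cocycle m \<beta> n holomorphic_on ball 0 1"
proof -
  have "(\<lambda>z. m (\<beta> ^ k * z)) holomorphic_on ball 0 1" for k
  proof -
    have "(*) (\<beta> ^ k) ` ball 0 1 \<subseteq> ball 0 1"
      using assms by (auto simp: norm_mult norm_power)
    then have "(m \<circ> (*) (\<beta> ^ k)) holomorphic_on ball 0 1"
      by (intro holomorphic_on_compose_gen[OF _ assms(1)] holomorphic_intros)
    then show ?thesis by (simp add: o_def)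
  qed
  then have "(\<lambda>z. \<Prod>k<n. m (\<beta> ^ k * z)) holomorphic_on ball 0 1"
    by (intro holomorphic_on_prod)
  then show ?thesis by (simp add: rotation_cocycle_def[abs_def])
qed

text \<open>The upper bound on a zero-free circle of radius above \<open>s\<close> passes to the
  inside by the maximum principle; \<open>\<epsilon>\<close> is taken so small that
  \<open>M_r m r * exp \<epsilon>\<close> stays below \<open>L\<close>.\<close>

lemma rotation_cocycle_disc_bound:
  assumes m: "m holomorphic_on ball 0 1" and \<beta>: "cmod \<beta> = 1" "\<forall>n::nat. n \<ge> 1 \<longrightarrow> \<beta> ^ n \<noteq> 1"
    and L: "M_1 m < ereal L" and s: "s < 1"
  shows "\<exists>C q. 0 \<le> C \<and> 0 \<le> q \<and> q < L \<and>
    (\<forall>n z. cmod z \<le> s \<longrightarrow> cmod (rotation_cocycle m \<beta> n z) \<le> C * q ^ n)"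
proof -
  have M: "M_r m r < L" if "0 < r" "r < 1" for r
  proof -
    have "ereal (M_r m r) \<le> M_1 m" unfolding M_1_def using that by (intro SUP_upper) auto
    then show ?thesis using L by (metis le_less_trans less_ereal.simps(1))
  qed
  have M0: "M_r m r \<ge> 0" for r by (simp add: M_r_def)
  have "L > 0" using M[of "1/2"] M0[of "1/2"] by simp
  show ?thesis
  proof (cases "\<exists>z\<in>ball 0 1. m z \<noteq> 0")
    case False
    \<comment> \<open>The rate 0 works because \<open>0 ^ 0 = 1\<close> matches the empty product at
      \<open>n = 0\<close>.\<close>
    have "cmod (rotation_cocycle m \<beta> n z) \<le> 1 * 0 ^ n" if "cmod z \<le> s" for n z
    proof (cases n)
      case (Suc k)
      have "m z = 0" using False that s by auto
      then show ?thesis using Suc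
        by (simp add: rotation_cocycle_def prod.lessThan_Suc_shift del: prod.lessThan_Suc)
    qed (simp add: rotation_cocycle_def)
    then show ?thesis using \<open>L > 0\<close> by (intro exI[of _ 1] exI[of _ 0]) auto
  next
    case True
    obtain r where r: "s < r" "0 < r" "r < 1" "\<forall>z\<in>sphere 0 r. m z \<noteq> 0"
      by (rule exists_zero_free_circle[OF m True s])
    have "((\<lambda>\<epsilon>. M_r m r * exp \<epsilon>) \<longlongrightarrow> M_r m r * exp 0) (at_right 0)"
      by (intro tendsto_intros)
    then have "eventually (\<lambda>\<epsilon>. M_r m r * exp \<epsilon> < L) (at_right 0)"
      using M[OF r(2,3)] by (intro order_tendstoD) auto
    moreover have "eventually (\<lambda>\<epsilon>::real. \<epsilon> > 0) (at_right 0)"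
      by (rule eventually_at_right_less)
    ultimately have "eventually (\<lambda>\<epsilon>. M_r m r * exp \<epsilon> < L \<and> \<epsilon> > 0) (at_right 0)"
      by (rule eventually_conj)
    then obtain \<epsilon> where \<epsilon>: "M_r m r * exp \<epsilon> < L" "\<epsilon> > 0"
      using eventually_happens'[OF trivial_limit_at_right_real] by blast
    obtain C where C: "C > 0"
      "\<And>n z. cmod z = r \<Longrightarrow> cmod (rotation_cocycle m \<beta> n z) \<le> C * (M_r m r * exp \<epsilon>) ^ n"
      using rotation_cocycle_circle_bounds[OF m r(2-4) \<beta> \<epsilon>(2)] by blast
    have "cmod (rotation_cocycle m \<beta> n z) \<le> C * (M_r m r * exp \<epsilon>) ^ n" if "cmod z \<le> s" for n z
    proof (rule maximum_modulus_frontier[of "rotation_cocycle m \<beta> n" "cball 0 r"])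
      show "rotation_cocycle m \<beta> n holomorphic_on interior (cball 0 r)"
        using r by (intro holomorphic_on_subset[OF rotation_cocycle_holomorphic[OF m \<beta>(1)]]) auto
      show "continuous_on (closure (cball 0 r)) (rotation_cocycle m \<beta> n)"
        using r by (intro holomorphic_on_imp_continuous_on
          holomorphic_on_subset[OF rotation_cocycle_holomorphic[OF m \<beta>(1)]]) auto
      show "cmod (rotation_cocycle m \<beta> n z) \<le> C * (M_r m r * exp \<epsilon>) ^ n"
        if "z \<in> frontier (cball 0 r)" for z
        using that r(2) by (intro C(2)) simp
    qed (use r(1) that in simp_all)
    moreover have "0 \<le> C" "0 \<le> M_r m r * exp \<epsilon>" using C(1) M0[of r] by simp_all
    ultimately show ?thesis using \<epsilon>(1) by blast
  qed
qed

section \<open>The Neumann series\<close>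

lemma rotation_cocycle_0 [simp]: "rotation_cocycle m \<beta> 0 z = 1"
  by (simp add: rotation_cocycle_def)

lemma rotation_cocycle_Suc: "rotation_cocycle m \<beta> (Suc n) z = m z * rotation_cocycle m \<beta> n (\<beta> * z)"
proof -
  have "m (\<beta> ^ Suc k * z) = m (\<beta> ^ k * (\<beta> * z))" for k by (simp add: mult_ac)
  then show ?thesis unfolding rotation_cocycle_def prod.lessThan_Suc_shift by simp
qed

lemma norm_power_mult_unit: "cmod \<beta> = 1 \<Longrightarrow> cmod (\<beta> ^ n * z) = cmod z"
  by (simp add: norm_mult norm_power)

lemma HolD_bounded_on_cball:
  assumes "f \<in> HolD" "s < 1"
  shows "\<exists>B\<ge>0. \<forall>z. cmod z \<le> s \<longrightarrow> cmod (f z) \<le> B"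
proof -
  have "f holomorphic_on ball 0 1" using assms(1) by (simp add: HolD_def)
  moreover have "cball (0::complex) s \<subseteq> ball 0 1" using assms(2) by auto
  ultimately have "continuous_on (cball 0 s) f"
    by (intro holomorphic_on_imp_continuous_on) (rule holomorphic_on_subset)
  then have "bounded (f ` cball 0 s)"
    by (intro compact_imp_bounded compact_continuous_image compact_cball)
  then obtain B where "B > 0" "\<forall>y\<in>f ` cball 0 s. cmod y \<le> B" unfolding bounded_pos by blast
  then have "B \<ge> 0 \<and> (\<forall>z. cmod z \<le> s \<longrightarrow> cmod (f z) \<le> B)" by simp
  then show ?thesis by blast
qed

text \<open>The value at \<open>z\<close> of \<open>T ^ n g / \<mu> ^ Suc n\<close>, the terms of
  the expansion of the resolvent in powers of \<open>1 / \<mu>\<close>.\<close>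

definition neumann_term where
  "neumann_term m \<beta> \<mu> g n z = rotation_cocycle m \<beta> n z * g (\<beta> ^ n * z) / \<mu> ^ Suc n" for \<mu> z :: complex

definition neumann where
  "neumann m \<beta> \<mu> g z = (if z \<in> ball 0 1 then \<Sum>n. neumann_term m \<beta> \<mu> g n z else 0)"

lemma norm_neumann_term_le:
  assumes L: "0 < L" "L \<le> cmod \<mu>"
    and w: "cmod (rotation_cocycle m \<beta> n z) \<le> C * q ^ n" and g: "cmod (g (\<beta> ^ n * z)) \<le> B"
  shows "cmod (neumann_term m \<beta> \<mu> g n z) \<le> C * B / L * (q / L) ^ n"
proof -
  have Cq: "0 \<le> C * q ^ n" using w norm_ge_zero order_trans by blast
  have pow: "L ^ Suc n \<le> cmod \<mu> ^ Suc n" using L by (intro power_mono) simp_all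
  have "cmod (rotation_cocycle m \<beta> n z) * cmod (g (\<beta> ^ n * z)) \<le> C * q ^ n * B"
    by (rule mult_mono[OF w g Cq norm_ge_zero])
  moreover have "0 \<le> C * q ^ n * B" using Cq order_trans[OF norm_ge_zero g] by (rule mult_nonneg_nonneg)
  moreover have "0 < L ^ Suc n" using L(1) by (rule zero_less_power)
  ultimately have "cmod (rotation_cocycle m \<beta> n z) * cmod (g (\<beta> ^ n * z)) / cmod \<mu> ^ Suc n \<le> C * q ^ n * B / L ^ Suc n"
    using pow by (intro frac_le)
  then have "cmod (neumann_term m \<beta> \<mu> g n z) \<le> C * q ^ n * B / L ^ Suc n"
    unfolding neumann_term_def norm_mult norm_divide norm_power .
  also have "\<dots> = C * B / L * (q / L) ^ n"
    using L by (simp add: power_divide)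
  finally show ?thesis .
qed

text \<open>The rate \<open>q\<close> may depend on \<open>s\<close>. As it is strictly below
  \<open>L\<close>, the series converges for all \<open>cmod \<mu> \<ge> L\<close>, boundary
  included.\<close>

definition cocycle_growth_below where
  "cocycle_growth_below m \<beta> L \<longleftrightarrow> (\<forall>s<1. \<exists>C q. 0 \<le> C \<and> 0 \<le> q \<and> q < L \<and>
    (\<forall>n z. cmod z \<le> s \<longrightarrow> cmod (rotation_cocycle m \<beta> n z) \<le> C * q ^ n))"

text \<open>One majorant serves all \<open>z\<close> and all \<open>\<mu>\<close>: uniformity in
  \<open>z\<close> gives holomorphy of the sum, uniformity in \<open>\<mu>\<close> the local
  boundedness in the Waelbroeck condition.\<close>

lemma neumann_term_majorant:
  assumes \<beta>: "cmod \<beta> = 1" and L: "0 < L" and growth: "cocycle_growth_below m \<beta> L"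
    and g: "g \<in> HolD" and s: "s < 1"
  shows "\<exists>M. summable M \<and> (\<forall>n z \<mu>. cmod z \<le> s \<longrightarrow> L \<le> cmod \<mu> \<longrightarrow> cmod (neumann_term m \<beta> \<mu> g n z) \<le> M n)"
proof -
  obtain C q where C: "0 \<le> C" "0 \<le> q" "q < L"
    "\<forall>n z. cmod z \<le> s \<longrightarrow> cmod (rotation_cocycle m \<beta> n z) \<le> C * q ^ n"
    using growth s unfolding cocycle_growth_below_def by blast
  obtain B where B: "B \<ge> 0" "\<forall>z. cmod z \<le> s \<longrightarrow> cmod (g z) \<le> B"
    using HolD_bounded_on_cball[OF g s] by blast
  have "summable (\<lambda>n. C * B / L * (q / L) ^ n)"
    using C L by (intro summable_mult summable_geometric) auto
  moreover have "cmod (neumann_term m \<beta> \<mu> g n z) \<le> C * B / L * (q / L) ^ n"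
    if "cmod z \<le> s" "L \<le> cmod \<mu>" for n z \<mu>
    using that C(4) B(2) by (intro norm_neumann_term_le L) (simp_all add: norm_power_mult_unit \<beta>)
  ultimately show ?thesis by blast
qed

lemma summable_neumann:
  assumes \<beta>: "cmod \<beta> = 1" and L: "0 < L" and growth: "cocycle_growth_below m \<beta> L"
    and g: "g \<in> HolD" and \<mu>: "L \<le> cmod \<mu>" and z: "z \<in> ball 0 1"
  shows "summable (\<lambda>n. neumann_term m \<beta> \<mu> g n z)"
proof -
  have "cmod z < 1" using z by simp
  then obtain M where M: "summable M"
    "\<forall>n y \<mu>. cmod y \<le> cmod z \<longrightarrow> L \<le> cmod \<mu> \<longrightarrow> cmod (neumann_term m \<beta> \<mu> g n y) \<le> M n"
    using neumann_term_majorant[OF \<beta> L growth g] by blast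
  then show ?thesis using \<mu> by (intro summable_comparison_test[OF _ M(1)] exI[of _ 0]) auto
qed

lemma neumann_term_holomorphic:
  assumes m: "m holomorphic_on ball 0 1" and \<beta>: "cmod \<beta> = 1" and "\<mu> \<noteq> 0" and g: "g \<in> HolD"
  shows "neumann_term m \<beta> \<mu> g n holomorphic_on ball 0 1"
proof -
  have "(*) (\<beta> ^ n) ` ball 0 1 \<subseteq> ball 0 1"
    using \<beta> by (auto simp: norm_power_mult_unit)
  moreover have "g holomorphic_on ball 0 1" using g by (simp add: HolD_def)
  ultimately have "(g \<circ> (*) (\<beta> ^ n)) holomorphic_on ball 0 1"
    by (intro holomorphic_on_compose_gen[of _ _ g "ball 0 1"] holomorphic_intros)
  then have "(\<lambda>z. rotation_cocycle m \<beta> n z * g (\<beta> ^ n * z) / \<mu> ^ Suc n) holomorphic_on ball 0 1"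
    using rotation_cocycle_holomorphic[OF m \<beta>, of n] \<open>\<mu> \<noteq> 0\<close>
    by (intro holomorphic_intros) (auto simp: o_def)
  then show ?thesis by (simp add: neumann_term_def[abs_def])
qed

lemma neumann_in_HolD:
  assumes m: "m holomorphic_on ball 0 1" and \<beta>: "cmod \<beta> = 1" and L: "0 < L"
    and growth: "cocycle_growth_below m \<beta> L" and g: "g \<in> HolD" and \<mu>: "L \<le> cmod \<mu>"
  shows "neumann m \<beta> \<mu> g \<in> HolD"
proof -
  have "\<mu> \<noteq> 0" using \<mu> L by auto
  have "(\<lambda>z. \<Sum>n. neumann_term m \<beta> \<mu> g n z) holomorphic_on ball 0 1"
  proof (rule holomorphic_uniform_sequence[where f = "\<lambda>N z. \<Sum>n<N. neumann_term m \<beta> \<mu> g n z"])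
    show "(\<lambda>z. \<Sum>n<N. neumann_term m \<beta> \<mu> g n z) holomorphic_on ball 0 1" for N
      using neumann_term_holomorphic[OF m \<beta> \<open>\<mu> \<noteq> 0\<close> g] by (intro holomorphic_on_sum)
    fix x :: complex assume x: "x \<in> ball 0 1"
    \<comment> \<open>Half the distance to the unit circle, so that the closed disc around
      \<open>x\<close> stays within radius \<open>s < 1\<close>.\<close>
    define d where "d = (1 - cmod x) / 2"
    define s where "s = (1 + cmod x) / 2"
    have "0 < d" "s < 1" using x by (auto simp: d_def s_def)
    have sub: "cmod z \<le> s" if "z \<in> cball x d" for z
      using that norm_triangle_sub[of z x] by (simp add: d_def s_def dist_norm norm_minus_commute)
    obtain M where M: "summable M"
      "\<forall>n y \<mu>. cmod y \<le> s \<longrightarrow> L \<le> cmod \<mu> \<longrightarrow> cmod (neumann_term m \<beta> \<mu> g n y) \<le> M n"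
      using neumann_term_majorant[OF \<beta> L growth g \<open>s < 1\<close>] by blast
    have "uniform_limit (cball x d) (\<lambda>N z. \<Sum>n<N. neumann_term m \<beta> \<mu> g n z)
        (\<lambda>z. \<Sum>n. neumann_term m \<beta> \<mu> g n z) sequentially"
      using M(2) sub \<mu> by (intro Weierstrass_m_test[OF _ M(1)]) blast
    moreover have "cball x d \<subseteq> ball 0 1" using sub \<open>s < 1\<close> by fastforce
    ultimately show "\<exists>d>0. cball x d \<subseteq> ball 0 1 \<and> uniform_limit (cball x d)
        (\<lambda>N z. \<Sum>n<N. neumann_term m \<beta> \<mu> g n z) (\<lambda>z. \<Sum>n. neumann_term m \<beta> \<mu> g n z) sequentially"
      using \<open>0 < d\<close> by blast
  qed simp
  then have "neumann m \<beta> \<mu> g holomorphic_on ball 0 1"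
    by (rule holomorphic_transform) (simp add: neumann_def)
  then show ?thesis by (simp add: HolD_def neumann_def)
qed

lemma neumann_solves:
  assumes \<beta>: "cmod \<beta> = 1" and L: "0 < L" and growth: "cocycle_growth_below m \<beta> L"
    and g: "g \<in> HolD" and \<mu>: "L \<le> cmod \<mu>"
  shows "(\<lambda>z. \<mu> * neumann m \<beta> \<mu> g z - weighted_comp m \<beta> (neumann m \<beta> \<mu> g) z) = g"
proof
  fix z
  show "\<mu> * neumann m \<beta> \<mu> g z - weighted_comp m \<beta> (neumann m \<beta> \<mu> g) z = g z"
  proof (cases "z \<in> ball 0 1")
    case False
    then show ?thesis using g by (auto simp: neumann_def weighted_comp_def HolD_def)
  next
    case True
    then have \<beta>z: "\<beta> * z \<in> ball 0 1" using norm_power_mult_unit[OF \<beta>, of 1] by simp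
    have "\<mu> \<noteq> 0" using \<mu> L by auto
    \<comment> \<open>Applying the operator to term \<open>n\<close> gives \<open>\<mu>\<close>
      times term \<open>Suc n\<close>; hence in the resolvent equation only the term of index 0
      survives, and it contributes \<open>g\<close>.\<close>
    have shift: "\<mu> * neumann_term m \<beta> \<mu> g (Suc n) z = m z * neumann_term m \<beta> \<mu> g n (\<beta> * z)" for n
      using \<open>\<mu> \<noteq> 0\<close> by (simp add: neumann_term_def rotation_cocycle_Suc mult_ac)
    have sS: "summable (\<lambda>n. neumann_term m \<beta> \<mu> g (Suc n) z)"
      using summable_neumann[OF \<beta> L growth g \<mu> True] by (rule summable_ignore_initial_segment[of _ 1, simplified])
    have "(\<Sum>n. neumann_term m \<beta> \<mu> g n z) = neumann_term m \<beta> \<mu> g 0 z + (\<Sum>n. neumann_term m \<beta> \<mu> g (Suc n) z)"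
      using suminf_split_head[OF summable_neumann[OF \<beta> L growth g \<mu> True]] by simp
    then have "\<mu> * neumann m \<beta> \<mu> g z = g z + \<mu> * (\<Sum>n. neumann_term m \<beta> \<mu> g (Suc n) z)"
      using True \<open>\<mu> \<noteq> 0\<close> by (simp add: neumann_def distrib_left neumann_term_def[of _ _ _ _ 0])
    also have "\<mu> * (\<Sum>n. neumann_term m \<beta> \<mu> g (Suc n) z) = (\<Sum>n. m z * neumann_term m \<beta> \<mu> g n (\<beta> * z))"
      using suminf_mult[OF sS, of \<mu>] by (simp only: shift)
    also have "\<dots> = m z * neumann m \<beta> \<mu> g (\<beta> * z)"
      using summable_neumann[OF \<beta> L growth g \<mu> \<beta>z] \<beta>z by (simp add: suminf_mult neumann_def)
    finally show ?thesis using True by (simp add: weighted_comp_def)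
  qed
qed

section \<open>Bijectivity of the resolvent equation for large \<open>\<mu>\<close>\<close>

lemma weighted_comp_in_HolD:
  assumes m: "m holomorphic_on ball 0 1" and \<beta>: "cmod \<beta> = 1" and f: "f \<in> HolD"
  shows "weighted_comp m \<beta> f \<in> HolD"
proof -
  have "(*) \<beta> ` ball 0 1 \<subseteq> ball 0 1" using \<beta> by (auto simp: norm_mult)
  moreover have "f holomorphic_on ball 0 1" using f by (simp add: HolD_def)
  ultimately have "(f \<circ> (*) \<beta>) holomorphic_on ball 0 1"
    by (intro holomorphic_on_compose_gen[of _ _ f "ball 0 1"] holomorphic_intros)
  then have "(\<lambda>z. m z * f (\<beta> * z)) holomorphic_on ball 0 1"
    using m by (intro holomorphic_intros) (auto simp: o_def)
  then have "weighted_comp m \<beta> f holomorphic_on ball 0 1"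
    by (rule holomorphic_transform) (simp add: weighted_comp_def)
  then show ?thesis by (simp add: HolD_def weighted_comp_def)
qed

text \<open>Iteration gives \<open>\<mu> ^ n * h z = rotation_cocycle m \<beta> n z * h (\<beta> ^ n
  * z)\<close>. The right side grows at a rate \<open>q < L \<le> cmod \<mu>\<close>, which forces
  \<open>h z = 0\<close>.\<close>

lemma eigenfunction_eq_0:
  assumes \<beta>: "cmod \<beta> = 1" and L: "0 < L" and growth: "cocycle_growth_below m \<beta> L"
    and h: "\<And>s. s < 1 \<Longrightarrow> \<exists>B\<ge>0. \<forall>z. cmod z \<le> s \<longrightarrow> cmod (h z) \<le> B" and \<mu>: "L \<le> cmod \<mu>"
    and eq: "\<And>z. z \<in> ball 0 1 \<Longrightarrow> \<mu> * h z = m z * h (\<beta> * z)" and z: "z \<in> ball 0 1"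
  shows "h z = (0::complex)"
proof -
  have iter: "\<mu> ^ n * h y = rotation_cocycle m \<beta> n y * h (\<beta> ^ n * y)" if "y \<in> ball 0 1" for n y
    using that
  proof (induction n arbitrary: y)
    case (Suc n)
    have "\<beta> * y \<in> ball 0 1" using Suc.prems norm_power_mult_unit[OF \<beta>, of 1] by simp
    have "\<mu> ^ Suc n * h y = \<mu> ^ n * (\<mu> * h y)" by simp
    also have "\<dots> = m y * (\<mu> ^ n * h (\<beta> * y))" using eq[OF Suc.prems] by simp
    also have "\<dots> = rotation_cocycle m \<beta> (Suc n) y * h (\<beta> ^ Suc n * y)"
      using Suc.IH[OF \<open>\<beta> * y \<in> ball 0 1\<close>] by (simp add: rotation_cocycle_Suc mult_ac)
    finally show ?case .
  qed simp
  define s where "s = cmod z"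
  have "s < 1" using z by (simp add: s_def)
  obtain C q where C: "0 \<le> C" "0 \<le> q" "q < L"
    "\<forall>n z. cmod z \<le> s \<longrightarrow> cmod (rotation_cocycle m \<beta> n z) \<le> C * q ^ n"
    using growth \<open>s < 1\<close> unfolding cocycle_growth_below_def by blast
  obtain B where B: "B \<ge> 0" "\<forall>z. cmod z \<le> s \<longrightarrow> cmod (h z) \<le> B" using h[OF \<open>s < 1\<close>] by blast
  have "cmod (h z) \<le> C * B * (q / L) ^ n" for n
  proof -
    have "L ^ n * cmod (h z) \<le> cmod \<mu> ^ n * cmod (h z)"
      using L \<mu> by (intro mult_right_mono power_mono) auto
    also have "\<dots> = cmod (rotation_cocycle m \<beta> n z) * cmod (h (\<beta> ^ n * z))"
      using arg_cong[OF iter[OF z, of n], of cmod] by (simp add: norm_mult norm_power)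
    also have "\<dots> \<le> C * q ^ n * B"
      using C B by (intro mult_mono) (auto simp: norm_power_mult_unit \<beta> s_def)
    finally show ?thesis using L by (simp add: field_simps power_divide)
  qed
  moreover have "(\<lambda>n. C * B * (q / L) ^ n) \<longlonglongrightarrow> C * B * 0"
    using C L by (intro tendsto_intros LIMSEQ_realpow_zero) auto
  ultimately have "cmod (h z) \<le> C * B * 0" by (intro LIMSEQ_le_const) auto
  then show ?thesis by simp
qed

lemma bij_betw_resolvent_equation:
  assumes m: "m holomorphic_on ball 0 1" and \<beta>: "cmod \<beta> = 1" and L: "0 < L"
    and growth: "cocycle_growth_below m \<beta> L" and \<mu>: "L \<le> cmod \<mu>"
  shows "bij_betw (\<lambda>f. (\<lambda>z. \<mu> * f z - weighted_comp m \<beta> f z)) HolD HolD"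
proof (rule bij_betw_imageI)
  show "inj_on (\<lambda>f. (\<lambda>z. \<mu> * f z - weighted_comp m \<beta> f z)) HolD"
  proof (rule inj_onI)
    fix f1 f2 assume f: "f1 \<in> HolD" "f2 \<in> HolD"
      and eq: "(\<lambda>z. \<mu> * f1 z - weighted_comp m \<beta> f1 z) = (\<lambda>z. \<mu> * f2 z - weighted_comp m \<beta> f2 z)"
    define h where "h z = f1 z - f2 z" for z
    have bound: "\<exists>B\<ge>0. \<forall>z. cmod z \<le> s \<longrightarrow> cmod (h z) \<le> B" if "s < 1" for s
    proof -
      have "f1 holomorphic_on ball 0 1" "f2 holomorphic_on ball 0 1" using f by (simp_all add: HolD_def)
      then have "h holomorphic_on ball 0 1" unfolding h_def by (rule holomorphic_on_diff)
      then have "h \<in> HolD" using f by (simp add: h_def HolD_def)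
      then show ?thesis using HolD_bounded_on_cball that by blast
    qed
    have "\<mu> * h z = m z * h (\<beta> * z)" if "z \<in> ball 0 1" for z
      using fun_cong[OF eq, of z] that by (simp add: weighted_comp_def h_def algebra_simps)
    then have "h z = 0" if "z \<in> ball 0 1" for z
      using eigenfunction_eq_0[OF \<beta> L growth bound \<mu> _ that] by blast
    then have "f1 z = f2 z" for z using f by (cases "z \<in> ball 0 1") (simp_all add: h_def HolD_def)
    then show "f1 = f2" by blast
  qed
  show "(\<lambda>f. (\<lambda>z. \<mu> * f z - weighted_comp m \<beta> f z)) ` HolD = HolD"
  proof (intro equalityI subsetI)
    fix g assume "g \<in> (\<lambda>f. (\<lambda>z. \<mu> * f z - weighted_comp m \<beta> f z)) ` HolD"
    then obtain f where f: "f \<in> HolD" "g = (\<lambda>z. \<mu> * f z - weighted_comp m \<beta> f z)" by blast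
    have "f holomorphic_on ball 0 1" "weighted_comp m \<beta> f holomorphic_on ball 0 1"
      using f(1) weighted_comp_in_HolD[OF m \<beta> f(1)] by (simp_all add: HolD_def)
    then have "g holomorphic_on ball 0 1" unfolding f(2) by (intro holomorphic_intros)
    then show "g \<in> HolD" using f(1) by (simp add: f(2) HolD_def weighted_comp_def)
  next
    fix g assume "g \<in> HolD"
    then show "g \<in> (\<lambda>f. (\<lambda>z. \<mu> * f z - weighted_comp m \<beta> f z)) ` HolD"
      using neumann_solves[OF \<beta> L growth _ \<mu>] neumann_in_HolD[OF m \<beta> L growth _ \<mu>]
      by (intro image_eqI[of _ _ "neumann m \<beta> \<mu> g"]) simp_all
  qed
qed

lemma resolvent_eq_neumann:
  assumes m: "m holomorphic_on ball 0 1" and \<beta>: "cmod \<beta> = 1" and L: "0 < L"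
    and growth: "cocycle_growth_below m \<beta> L" and \<mu>: "L \<le> cmod \<mu>" and g: "g \<in> HolD"
  shows "resolvent (weighted_comp m \<beta>) \<mu> g = neumann m \<beta> \<mu> g"
  unfolding resolvent_def
  using inv_into_f_f[OF bij_betw_imp_inj_on[OF bij_betw_resolvent_equation[OF m \<beta> L growth \<mu>]]
    neumann_in_HolD[OF m \<beta> L growth g \<mu>]]
  by (simp only: neumann_solves[OF \<beta> L growth g \<mu>])

lemma outside_in_waelbroeck_resolvent_set:
  assumes m: "m holomorphic_on ball 0 1" and \<beta>: "cmod \<beta> = 1" and L: "0 < L" "L < cmod lam"
    and growth: "cocycle_growth_below m \<beta> L"
  shows "lam \<in> waelbroeck_resolvent_set (weighted_comp m \<beta>)"
proof -
  \<comment> \<open>The closed disc of this radius just reaches \<open>cmod \<mu> = L\<close>, where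
    the majorant still applies.\<close>
  define \<delta> where "\<delta> = cmod lam - L"
  have "\<delta> > 0" using L by (simp add: \<delta>_def)
  have far: "L \<le> cmod \<mu>" if "\<mu> \<in> cball lam \<delta>" for \<mu>
    using that norm_triangle_sub[of lam \<mu>] by (simp add: \<delta>_def dist_norm)
  have sub: "cball lam \<delta> \<subseteq> resolvent_set (weighted_comp m \<beta>)"
    using far bij_betw_resolvent_equation[OF m \<beta> L(1) growth] by (auto simp: resolvent_set_def)
  moreover have "lam \<in> cball lam \<delta>" using \<open>\<delta> > 0\<close> by simp
  ultimately have "lam \<in> resolvent_set (weighted_comp m \<beta>)" by blast
  moreover have "bdd_above ((\<lambda>\<mu>. semi_norm_A r (resolvent (weighted_comp m \<beta>) \<mu> g)) ` cball lam \<delta>)"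
    if g: "g \<in> HolD" and r: "0 < r" "r < 1" for g r
  proof -
    obtain M where M: "summable M"
      "\<forall>n y \<mu>. cmod y \<le> r \<longrightarrow> L \<le> cmod \<mu> \<longrightarrow> cmod (neumann_term m \<beta> \<mu> g n y) \<le> M n"
      using neumann_term_majorant[OF \<beta> L(1) growth g r(2)] by blast
    have "semi_norm_A r (resolvent (weighted_comp m \<beta>) \<mu> g) \<le> suminf M" if "\<mu> \<in> cball lam \<delta>" for \<mu>
      unfolding resolvent_eq_neumann[OF m \<beta> L(1) growth far[OF that] g] semi_norm_A_def
    proof (rule cSUP_least)
      show "cball (0::complex) r \<noteq> {}" using r by simp
      fix z :: complex assume "z \<in> cball 0 r"
      then have z: "cmod z \<le> r" by simp
      have "cmod (\<Sum>n. neumann_term m \<beta> \<mu> g n z) \<le> suminf M"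
        using M(2) z far[OF that] by (intro norm_suminf_le M(1)) blast
      then show "cmod (neumann m \<beta> \<mu> g z) \<le> suminf M" using z r by (simp add: neumann_def)
    qed
    then show ?thesis by (intro bdd_aboveI2)
  qed
  ultimately show ?thesis
    using sub \<open>\<delta> > 0\<close> unfolding waelbroeck_resolvent_set_def
    by (intro CollectI conjI exI[of _ \<delta>] ballI allI impI) simp_all
qed

section \<open>The contour integral obstruction\<close>

lemma not_open_subset_resolvent_set:
  assumes m: "m holomorphic_on ball 0 1"
    and \<beta>: "cmod \<beta> = 1" "\<forall>n::nat. n \<ge> 1 \<longrightarrow> \<beta> ^ n \<noteq> 1"
    and r: "0 < r" "r < 1" and nz: "\<forall>z\<in>sphere 0 r. m z \<noteq> 0"
    and z0: "cmod z0 < r" "m z0 = 0"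
    and U: "open U" "U \<subseteq> resolvent_set (weighted_comp m \<beta>)" "lam \<in> U" and lam: "cmod lam < M_r m r"
  shows False
proof -
  let ?w = "rotation_cocycle m \<beta>"
  \<comment> \<open>A small \<open>\<epsilon>\<close> keeps the lower growth rate \<open>Q\<close>
    of the cocycle strictly above \<open>cmod lam\<close>.\<close>
  have "((\<lambda>\<epsilon>. M_r m r * exp (- \<epsilon>)) \<longlongrightarrow> M_r m r * exp (- 0)) (at_right 0)"
    by (intro tendsto_intros)
  then have "eventually (\<lambda>\<epsilon>. cmod lam < M_r m r * exp (- \<epsilon>)) (at_right 0)"
    using lam by (intro order_tendstoD) auto
  then have "eventually (\<lambda>\<epsilon>. cmod lam < M_r m r * exp (- \<epsilon>) \<and> \<epsilon> > 0) (at_right 0)"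
    by (intro eventually_conj eventually_at_right_less)
  then obtain \<epsilon> where \<epsilon>: "cmod lam < M_r m r * exp (- \<epsilon>)" "\<epsilon> > 0"
    using eventually_happens'[OF trivial_limit_at_right_real] by blast
  define Q where "Q = M_r m r * exp (- \<epsilon>)"
  have Q: "cmod lam < Q" "0 < Q"
    using \<epsilon>(1) le_less_trans[OF norm_ge_zero \<epsilon>(1)] by (simp_all only: Q_def)
  obtain C where C: "C > 0" "\<And>n z. cmod z = r \<Longrightarrow> Q ^ n \<le> C * cmod (?w n z)"
    using rotation_cocycle_circle_bounds[OF m r nz \<beta> \<epsilon>(2)] unfolding Q_def by blast
  have wnz: "?w n z \<noteq> 0" if "cmod z = r" for n z
  proof
    assume "?w n z = 0"
    then have "Q ^ n \<le> 0" using C(2)[OF that, of n] by simp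
    then show False using zero_less_power[OF Q(2), of n] by simp
  qed
  have inv_w: "1 / cmod (?w n z) \<le> C / Q ^ n" if "cmod z = r" for n z
    using C(2)[OF that, of n] wnz[OF that, of n] Q(2) by (simp add: field_simps)

  define b where "b = inverse \<beta>"
  have "\<beta> \<noteq> 0" using \<beta>(1) by auto
  have b: "cmod b = 1" using \<beta>(1) by (simp add: b_def norm_inverse)
  have \<beta>b: "\<beta> * (b ^ Suc n * z) = b ^ n * z" for n z
    using \<open>\<beta> \<noteq> 0\<close> by (simp add: b_def)

  \<comment> \<open>The quotient \<open>m z / (z - z0)\<close> with its removable singularity filled
    in; it is holomorphic because \<open>m z0 = 0\<close>.\<close>
  define g0 where "g0 = (\<lambda>z. if z = z0 then deriv m z0 else (m z - m z0) / (z - z0))"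
  define g where "g z = (if z \<in> ball 0 1 then g0 z else 0)" for z
  have "g0 holomorphic_on ball 0 1" unfolding g0_def by (rule pole_lemma_open[OF m open_ball])
  then have "g holomorphic_on ball 0 1" by (rule holomorphic_transform) (simp add: g_def)
  then have g: "g \<in> HolD" by (simp add: HolD_def g_def)
  have g_circle: "g z = m z / (z - z0)" if "cmod z = r" for z
  proof -
    have "z \<noteq> z0" "z \<in> ball 0 1" using that z0 r by auto
    then show ?thesis using z0(2) by (simp add: g_def g0_def)
  qed

  \<comment> \<open>Solving at \<open>y = b * z\<close> gives
    \<open>f z = (\<mu> * f y - g y) / m y\<close>. Repeating this backwards along the orbit yields
    formally \<open>f z = - (\<Sum>k. \<mu> ^ k * v k z)\<close>, and \<open>c k\<close> is the
    integral of the coefficient.\<close>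
  define v where "v k z = g (b ^ Suc k * z) / ?w (Suc k) (b ^ Suc k * z)" for k z
  define c where "c k = contour_integral (circlepath 0 r) (v k)" for k
  obtain B where B: "B \<ge> 0" "\<forall>z. cmod z \<le> r \<longrightarrow> cmod (g z) \<le> B"
    using HolD_bounded_on_cball[OF g r(2)] by blast
  have circ: "cmod (b ^ k * z) = r" if "cmod z = r" for k z
    using that norm_power_mult_unit[OF b] by simp
  have v_int: "(v k has_contour_integral c k) (circlepath 0 r)" for k
  proof -
    have sub: "(*) (b ^ Suc k) ` sphere 0 r \<subseteq> sphere 0 r"
      using norm_power_mult_unit[OF b, of "Suc k"] by (auto simp del: power_Suc)
    have sph: "sphere (0::complex) r \<subseteq> ball 0 1" using r by auto
    have "continuous_on (sphere 0 r) (\<lambda>y. g y / ?w (Suc k) y)"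
      using g rotation_cocycle_holomorphic[OF m \<beta>(1), of "Suc k"] wnz sph
      by (intro continuous_on_divide holomorphic_on_imp_continuous_on)
        (auto simp: HolD_def intro: holomorphic_on_subset)
    then have "continuous_on ((*) (b ^ Suc k) ` sphere 0 r) (\<lambda>y. g y / ?w (Suc k) y)"
      using sub by (rule continuous_on_subset)
    then have "continuous_on (sphere 0 r) ((\<lambda>y. g y / ?w (Suc k) y) \<circ> (*) (b ^ Suc k))"
      by (rule continuous_on_compose[rotated]) (intro continuous_intros)
    then have "continuous_on (sphere 0 r) (v k)" by (simp add: o_def v_def[abs_def])
    then show ?thesis unfolding c_def using r
      by (intro has_contour_integral_integral contour_integrable_continuous_circlepath) simp
  qed
  have v_bound: "cmod (v k z) \<le> B * C / Q ^ Suc k" if "cmod z = r" for k z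
  proof -
    have "cmod (v k z) = cmod (g (b ^ Suc k * z)) * (1 / cmod (?w (Suc k) (b ^ Suc k * z)))"
      by (simp add: v_def norm_divide del: power_Suc)
    also have "\<dots> \<le> B * (C / Q ^ Suc k)"
      using B circ[OF that, of "Suc k"] by (intro mult_mono inv_w) (auto simp del: power_Suc)
    finally show ?thesis by simp
  qed
  have c_bound: "cmod (c k) \<le> B * C / Q ^ Suc k * (2 * pi * r)" for k
    using B(1) C(1) Q(2) by (intro has_contour_integral_bound_circlepath[OF v_int _ r(1)] v_bound) auto

  have sums0: "(\<lambda>k. c k * \<mu> ^ k) sums 0" if \<mu>: "\<mu> \<in> U" "cmod \<mu> < Q" for \<mu>
  proof -
    have "g \<in> (\<lambda>f. (\<lambda>z. \<mu> * f z - weighted_comp m \<beta> f z)) ` HolD"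
      using bij_betw_imp_surj_on[of "\<lambda>f. (\<lambda>z. \<mu> * f z - weighted_comp m \<beta> f z)" HolD HolD] \<mu>(1) U(2) g
      by (auto simp: resolvent_set_def)
    then obtain f where f: "f \<in> HolD" "g = (\<lambda>z. \<mu> * f z - weighted_comp m \<beta> f z)" by blast
    have eq: "\<mu> * f y - m y * f (\<beta> * y) = g y" if "cmod y = r" for y
      using fun_cong[OF f(2), of y] that r by (simp add: weighted_comp_def)
    \<comment> \<open>The finite form of the backward expansion. Its remainder is of size
      \<open>(cmod \<mu> / Q) ^ n\<close> by the lower bound on the cocycle.\<close>
    have expand: "f z = \<mu> ^ n * (f (b ^ n * z) / ?w n (b ^ n * z)) - (\<Sum>k<n. \<mu> ^ k * v k z)"
      if z: "cmod z = r" for n z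
    proof (induction n)
      case (Suc n)
      define y where "y = b ^ Suc n * z"
      have y: "cmod y = r" unfolding y_def by (rule circ[OF z])
      have \<beta>y: "\<beta> * y = b ^ n * z" unfolding y_def by (rule \<beta>b)
      have w: "?w (Suc n) y = m y * ?w n (b ^ n * z)" by (simp add: rotation_cocycle_Suc \<beta>y)
      have "m y \<noteq> 0" using nz y by simp
      moreover have "m y * f (b ^ n * z) = \<mu> * f y - g y" using eq[OF y] by (simp add: \<beta>y algebra_simps)
      ultimately have "f (b ^ n * z) / ?w n (b ^ n * z) = (\<mu> * f y - g y) / ?w (Suc n) y"
        unfolding w by (metis mult_divide_mult_cancel_left)
      also have "\<dots> = \<mu> * (f y / ?w (Suc n) y) - v n z"
        by (simp add: v_def y_def diff_divide_distrib)
      finally have e: "f (b ^ n * z) / ?w n (b ^ n * z) = \<mu> * (f y / ?w (Suc n) y) - v n z" .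
      have alg: "\<mu> ^ n * (\<mu> * G - V) - S = \<mu> ^ Suc n * G - (S + \<mu> ^ n * V)" for G V S
        by (simp add: algebra_simps)
      show ?case using Suc.IH unfolding y_def[symmetric] sum.lessThan_Suc e alg .
    qed simp
    obtain D where D: "D \<ge> 0" "\<forall>z. cmod z \<le> r \<longrightarrow> cmod (f z) \<le> D"
      using HolD_bounded_on_cball[OF f(1) r(2)] by blast
    have f_int: "(f has_contour_integral 0) (circlepath 0 r)"
    proof (rule Cauchy_theorem_disc_simple[of f 0 1])
      show "f holomorphic_on ball 0 1" using f(1) by (simp add: HolD_def)
      show "path_image (circlepath 0 r) \<subseteq> ball 0 1" using r by auto
    qed simp_all
    have bound: "cmod (\<Sum>k<n. \<mu> ^ k * c k) \<le> D * C * (2 * pi * r) * (cmod \<mu> / Q) ^ n" for n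
    proof -
      \<comment> \<open>By Cauchy's theorem \<open>f\<close> contributes 0, so the partial sum of
        the \<open>c k\<close> equals the integral of the remainder alone.\<close>
      have "((\<lambda>z. f z + (\<Sum>k<n. \<mu> ^ k * v k z)) has_contour_integral 0 + (\<Sum>k<n. \<mu> ^ k * c k)) (circlepath 0 r)"
        by (intro has_contour_integral_add f_int has_contour_integral_sum has_contour_integral_lmul v_int) simp
      moreover have "cmod (f z + (\<Sum>k<n. \<mu> ^ k * v k z)) \<le> cmod \<mu> ^ n * (D * (C / Q ^ n))"
        if "cmod z = r" for z
      proof -
        have "f z + (\<Sum>k<n. \<mu> ^ k * v k z) = \<mu> ^ n * (f (b ^ n * z) / ?w n (b ^ n * z))"
          by (subst expand[OF that, of n]) simp
        then have "cmod (f z + (\<Sum>k<n. \<mu> ^ k * v k z))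
            = cmod \<mu> ^ n * (cmod (f (b ^ n * z)) * (1 / cmod (?w n (b ^ n * z))))"
          by (simp add: norm_mult norm_divide norm_power)
        also have "\<dots> \<le> cmod \<mu> ^ n * (D * (C / Q ^ n))"
          using D circ[OF that, of n] by (intro mult_left_mono mult_mono inv_w) auto
        finally show ?thesis .
      qed
      ultimately have "cmod (0 + (\<Sum>k<n. \<mu> ^ k * c k)) \<le> cmod \<mu> ^ n * (D * (C / Q ^ n)) * (2 * pi * r)"
        using D(1) C(1) Q(2) by (intro has_contour_integral_bound_circlepath[OF _ _ r(1)]) auto
      then show ?thesis by (simp add: power_divide mult_ac)
    qed
    have "(\<lambda>n. (cmod \<mu> / Q) ^ n) \<longlonglongrightarrow> 0"
      using \<mu>(2) Q(2) by (intro LIMSEQ_realpow_zero) simp_all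
    then have "(\<lambda>n. D * C * (2 * pi * r) * (cmod \<mu> / Q) ^ n) \<longlonglongrightarrow> 0"
      by (rule tendsto_mult_right_zero)
    then have "(\<lambda>n. \<Sum>k<n. \<mu> ^ k * c k) \<longlonglongrightarrow> 0"
      by (rule Lim_null_comparison[OF always_eventually[OF allI[OF bound]]])
    then show ?thesis by (simp add: sums_def mult.commute)
  qed

  \<comment> \<open>The bound on \<open>c k\<close> makes this series converge for
    \<open>cmod \<mu> < Q\<close>. It vanishes on an open piece around \<open>lam\<close>, hence on
    the connected disc, and its value at 0 is \<open>c 0\<close>.\<close>
  define \<Phi> where "\<Phi> \<mu> = (\<Sum>k. c k * \<mu> ^ k)" for \<mu>
  have "\<Phi> holomorphic_on ball 0 Q"
  proof (rule power_series_holomorphic)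
    fix \<mu> :: complex assume "\<mu> \<in> ball 0 Q"
    then have \<mu>: "cmod \<mu> < Q" by simp
    have "summable (\<lambda>k. B * C / Q * (2 * pi * r) * (cmod \<mu> / Q) ^ k)"
      using \<mu> Q(2) by (intro summable_mult summable_geometric) auto
    moreover have "cmod (c k * \<mu> ^ k) \<le> B * C / Q * (2 * pi * r) * (cmod \<mu> / Q) ^ k" for k
    proof -
      have "cmod (c k * \<mu> ^ k) \<le> B * C / Q ^ Suc k * (2 * pi * r) * cmod \<mu> ^ k"
        unfolding norm_mult norm_power by (intro mult_right_mono c_bound) simp
      then show ?thesis by (simp add: power_divide mult_ac)
    qed
    ultimately have "summable (\<lambda>k. c k * \<mu> ^ k)"
      by (rule summable_comparison_test'[of _ 0])
    then show "(\<lambda>k. c k * (\<mu> - 0) ^ k) sums \<Phi> \<mu>" by (simp add: \<Phi>_def summable_sums)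
  qed
  have "\<Phi> 0 = 0"
  proof (rule analytic_continuation_open[where s = "U \<inter> ball 0 Q" and s' = "ball 0 Q" and f = \<Phi> and g = "\<lambda>_. 0"])
    show "\<Phi> holomorphic_on ball 0 Q" by fact
    have "lam \<in> U \<inter> ball 0 Q" using U(3) Q(1) by simp
    then show "U \<inter> ball 0 Q \<noteq> {}" by blast
    show "\<Phi> \<mu> = 0" if "\<mu> \<in> U \<inter> ball 0 Q" for \<mu>
      unfolding \<Phi>_def using that by (intro sums_unique[symmetric] sums0) simp_all
  qed (use U(1) Q(2) in \<open>simp_all add: open_Int\<close>)
  moreover have "\<Phi> 0 = c 0" by (simp add: \<Phi>_def)
  moreover have "c 0 = 2 * of_real pi * \<i> * \<beta>"
  proof -
    \<comment> \<open>The factor \<open>m\<close> cancels in \<open>v 0\<close>, leaving a simple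
      pole at \<open>\<beta> * z0\<close>, which the circle encloses.\<close>
    have "((\<lambda>u. \<beta> / (u - \<beta> * z0)) has_contour_integral (2 * of_real pi * \<i> * \<beta>)) (circlepath 0 r)"
      using z0(1) \<beta>(1) by (intro Cauchy_integral_circlepath_simple[of "\<lambda>_. \<beta>"]) (auto simp: norm_mult)
    then have "(v 0 has_contour_integral (2 * of_real pi * \<i> * \<beta>)) (circlepath 0 r)"
    proof (rule has_contour_integral_eq)
      fix z assume "z \<in> path_image (circlepath 0 r)"
      then have z: "cmod z = r" using r(1) by simp
      have bz: "cmod (b * z) = r" using circ[OF z, of 1] by simp
      then have "m (b * z) \<noteq> 0" using nz by simp
      then have "v 0 z = 1 / (b * z - z0)" using bz by (simp add: v_def rotation_cocycle_Suc g_circle)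
      also have "b * z - z0 = (z - \<beta> * z0) / \<beta>" using \<open>\<beta> \<noteq> 0\<close> by (simp add: b_def field_simps)
      finally show "\<beta> / (z - \<beta> * z0) = v 0 z" by simp
    qed
    then show ?thesis unfolding c_def by (rule contour_integral_unique)
  qed
  ultimately show False using \<open>\<beta> \<noteq> 0\<close> by simp
qed

text \<open>A resolvent disc around \<open>lam\<close> contains a point \<open>lam'\<close> with
  modulus strictly below \<open>M_1 m\<close>, hence below \<open>M_r m r\<close> for some
  \<open>r\<close>. This also reaches the boundary of the closed disc.\<close>

lemma disc_disjoint_waelbroeck_resolvent_set:
  assumes m: "m holomorphic_on ball 0 1"
    and \<beta>: "cmod \<beta> = 1" "\<forall>n::nat. n \<ge> 1 \<longrightarrow> \<beta> ^ n \<noteq> 1"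
    and z0: "z0 \<in> ball 0 1" "m z0 = 0" and lam: "ereal (cmod lam) \<le> M_1 m"
  shows "lam \<notin> waelbroeck_resolvent_set (weighted_comp m \<beta>)"
proof
  assume "lam \<in> waelbroeck_resolvent_set (weighted_comp m \<beta>)"
  then obtain \<delta> where \<delta>: "\<delta> > 0" "cball lam \<delta> \<subseteq> resolvent_set (weighted_comp m \<beta>)"
    by (auto simp: waelbroeck_resolvent_set_def)
  then have lam_res: "lam \<in> resolvent_set (weighted_comp m \<beta>)" by auto
  show False
  proof (cases "\<exists>z\<in>ball 0 1. m z \<noteq> 0")
    case False
    then have zero: "\<forall>z\<in>ball 0 1. m z = 0" by blast
    then have "M_r m r = 0" for r by (simp add: M_r_def)
    then have "M_1 m = 0" by (simp add: M_1_def zero_ereal_def)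
    then have "lam = 0" using lam by simp
    have "weighted_comp m \<beta> f = (\<lambda>z. 0)" for f using zero by (auto simp: weighted_comp_def)
    then have "inj_on (\<lambda>f::complex \<Rightarrow> complex. (\<lambda>z::complex. 0::complex)) HolD"
      using lam_res \<open>lam = 0\<close> by (simp add: resolvent_set_def bij_betw_def)
    \<comment> \<open>For \<open>m = 0\<close> the operator is 0 and \<open>lam = 0\<close>; the
      constant 1 and the constant 0 then have the same image.\<close>
    moreover define e where "e = (\<lambda>z::complex. if z \<in> ball 0 1 then 1 else 0 :: complex)"
    have "e holomorphic_on ball 0 1" by (rule holomorphic_transform[of "\<lambda>_. 1"]) (simp_all add: e_def)
    then have "e \<in> HolD" "(\<lambda>_. 0) \<in> HolD" by (simp_all add: HolD_def e_def)
    ultimately have "e = (\<lambda>_. 0)" by (auto dest: inj_onD)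
    then have "e 0 = 0" by simp
    then show False by (simp add: e_def)
  next
    case True
    \<comment> \<open>Scaling by \<open>t\<close> moves \<open>lam\<close> by at most
      \<open>\<delta> / 2\<close>; the summand 1 avoids a zero denominator.\<close>
    define t where "t = max 0 (1 - \<delta> / (2 * (cmod lam + 1)))"
    define lam' where "lam' = complex_of_real t * lam"
    have t: "0 \<le> t" "t < 1" using \<delta>(1) norm_ge_zero[of lam] by (auto simp: t_def add_nonneg_pos)
    have "dist lam lam' < \<delta>"
    proof -
      have "dist lam lam' = cmod (complex_of_real (1 - t) * lam)" by (simp add: lam'_def dist_norm algebra_simps)
      also have "\<dots> = (1 - t) * cmod lam" using t by (simp add: norm_mult del: of_real_diff)
      also have "\<dots> \<le> \<delta> / (2 * (cmod lam + 1)) * (cmod lam + 1)"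
        using t by (intro mult_mono) (auto simp: t_def)
      also have "\<dots> = \<delta> / 2" using norm_ge_zero[of lam] by (simp add: field_simps add_nonneg_eq_0_iff)
      finally show ?thesis using \<delta>(1) by simp
    qed
    have pos: "M_r m r > 0" for r using True by (auto simp: M_r_def)
    have "ereal (cmod lam') < M_1 m"
    \<comment> \<open>Scaling does not shrink the modulus of 0, but then positivity of the means
      gives the strict inequality.\<close>
    proof (cases "lam = 0")
      case True
      have "ereal (M_r m (1/2)) \<le> M_1 m" unfolding M_1_def by (intro SUP_upper) auto
      then show ?thesis using True pos[of "1/2"] less_le_trans[of 0 "ereal (M_r m (1/2))"]
        by (simp add: lam'_def zero_ereal_def[symmetric])
    next
      case False
      then have "cmod lam' < cmod lam" using t by (simp add: lam'_def norm_mult)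
      then show ?thesis using lam by (metis less_ereal.simps(1) less_le_trans)
    qed
    then obtain r where r: "0 < r" "r < 1" "cmod lam' < M_r m r"
      unfolding M_1_def less_SUP_iff by auto
    \<comment> \<open>The radius grows until the circle encloses \<open>z0\<close> and avoids all
      zeros; monotonicity of the means keeps \<open>cmod lam'\<close> below them.\<close>
    have "max r (cmod z0) < 1" using r z0 by simp
    then obtain r' where r': "max r (cmod z0) < r'" "0 < r'" "r' < 1" "\<forall>z\<in>sphere 0 r'. m z \<noteq> 0"
      using exists_zero_free_circle[OF m True] by metis
    have "M_r m r \<le> M_r m r'" using r' r by (intro M_r_le_M_r[OF m True]) auto
    then have "cmod lam' < M_r m r'" using r(3) by simp
    moreover have "lam' \<in> ball lam \<delta>" "ball lam \<delta> \<subseteq> resolvent_set (weighted_comp m \<beta>)"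
      using \<delta> \<open>dist lam lam' < \<delta>\<close> by auto
    moreover have "cmod z0 < r'" using r'(1) by simp
    ultimately show False
      using not_open_subset_resolvent_set[OF m \<beta> r'(2-4) _ z0(2) open_ball] by blast
  qed
qed

theorem theorem7p5:
  fixes \<beta> :: complex and m :: "complex \<Rightarrow> complex" and z0 :: complex
  assumes "cmod \<beta> = 1"
    and "\<forall>n::nat. n \<ge> 1 \<longrightarrow> \<beta> ^ n \<noteq> 1"
    and "m holomorphic_on ball 0 1"
    and "z0 \<in> ball 0 1" and "m z0 = 0"
  shows "(M_1 m < \<infinity> \<longrightarrow>
           waelbroeck_spectrum (weighted_comp m \<beta>) = {lam. ereal (cmod lam) \<le> M_1 m})
       \<and> (M_1 m = \<infinity> \<longrightarrow> waelbroeck_spectrum (weighted_comp m \<beta>) = UNIV)"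
proof -
  have "lam \<in> waelbroeck_resolvent_set (weighted_comp m \<beta>)" if lam: "\<not> ereal (cmod lam) \<le> M_1 m" for lam
  proof -
    have "M_1 m < ereal (cmod lam)" using lam by simp
    then obtain L where L: "M_1 m < ereal L" "ereal L < ereal (cmod lam)" using ereal_dense2 by blast
    have "ereal (M_r m (1/2)) \<le> M_1 m" unfolding M_1_def by (intro SUP_upper) auto
    then have "ereal (M_r m (1/2)) < ereal L" using L(1) by (rule le_less_trans)
    moreover have "0 \<le> M_r m (1/2)" by (simp add: M_r_def)
    ultimately have "0 < L" by simp
    moreover have "cocycle_growth_below m \<beta> L"
      unfolding cocycle_growth_below_def using rotation_cocycle_disc_bound[OF assms(3,1,2) L(1)] by blast
    ultimately show ?thesis
      using outside_in_waelbroeck_resolvent_set[OF assms(3,1)] L(2) by simp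
  qed
  moreover have "lam \<notin> waelbroeck_resolvent_set (weighted_comp m \<beta>)" if "ereal (cmod lam) \<le> M_1 m" for lam
    using disc_disjoint_waelbroeck_resolvent_set[OF assms(3,1,2,4,5) that] .
  ultimately have "waelbroeck_spectrum (weighted_comp m \<beta>) = {lam. ereal (cmod lam) \<le> M_1 m}"
    unfolding waelbroeck_spectrum_def by blast
  \<comment> \<open>If \<open>M_1 m = \<infinity>\<close>, the set on the right is the whole plane,
    so one equation settles both cases.\<close>
  then show ?thesis by simp
qed

end
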